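(* Let $\tau\ge\omega$ be a cardinal number. The following conditions are equivalent for any topological $\mathrm{AE}(0)$-group $G$ of weight $\tau$: (i) $G$ is (topologically and algebraically) isomorphic to a closed subgroup of $S_\infty^\tau$; (ii) $G$ admits a neighborhood basis at the identity consisting of open subgroups.
   Context: All topological spaces are Tychonoff and all maps are continuous; $\dim$ is Lebesgue covering dimension. $S_\infty$ is the symmetric group, i.e. the group of all bijections of $\mathbb N$ with the relative topology inherited from $\mathbb N^{\mathbb N}$ (product topology, $\mathbb N$ discrete); $S_\infty^\tau$ is its $\tau$-th power with the product topology. $C(X)$ is the set of continuous real-valued functions on $X$; for a map $f\colon Z_0\to X$, $C(f)(\psi)=\psi\circ f$. A space $X$ is an $\mathrm{AE}(0)$-space if for each space $Z$ with $\dim Z\le 0$ and each subspace $Z_0\subseteq Z$, every map $f\colon Z_0\to X$ such that $C(f)(C(X))\subseteq\{\varphi|Z_0\colon\varphi\in C(Z)\}$ can be extended to a map $Z\to X$. An $\mathrm{AE}(0)$-group is a topological group whose underlying space is an $\mathrm{AE}(0)$-space. *)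

theory Defs
  imports "HOL-Analysis.Analysis" "HOL-Algebra.Bij" "HOL-Algebra.Product_Groups"
begin

unbundle cardinal_syntax

section \<open>Topological notions\<close>

definition Tychonoff_space :: "'a topology \<Rightarrow> bool" where
  "Tychonoff_space X \<longleftrightarrow> completely_regular_space X \<and> Hausdorff_space X"

definition base_of :: "'a topology \<Rightarrow> 'a set set \<Rightarrow> bool" where
  "base_of X \<B> \<longleftrightarrow> (\<forall>V\<in>\<B>. openin X V) \<and>
     (\<forall>U x. openin X U \<and> x \<in> U \<longrightarrow> (\<exists>V\<in>\<B>. x \<in> V \<and> V \<subseteq> U))"

text \<open>The weight of a space is the least cardinality of a base. Cardinals are represented, as in
  the library, by cardinal orders \<open>\<tau>\<close>, up to \<open>=o\<close>.\<close>

definition has_weight :: "'a topology \<Rightarrow> 'i rel \<Rightarrow> bool" where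
  "has_weight X \<tau> \<longleftrightarrow> (\<exists>\<B>. base_of X \<B> \<and> |\<B>| =o \<tau>) \<and> (\<forall>\<B>. base_of X \<B> \<longrightarrow> \<tau> \<le>o |\<B>| )"

definition functionally_open :: "'a topology \<Rightarrow> 'a set \<Rightarrow> bool" where
  "functionally_open X U \<longleftrightarrow>
     (\<exists>\<phi>. continuous_map X euclideanreal \<phi> \<and> U = {x \<in> topspace X. \<phi> x \<noteq> 0})"

text \<open>Lebesgue covering dimension of Tychonoff spaces, via finite functionally open covers (for
  normal spaces this agrees with the definition via finite open covers). Note that the library's
  \<open>dim_le\<close> is the small inductive dimension, a different notion.\<close>

definition covering_dim_le :: "'a topology \<Rightarrow> nat \<Rightarrow> bool" where
  "covering_dim_le X n \<longleftrightarrow>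
     (\<forall>\<U>. finite \<U> \<and> (\<forall>U\<in>\<U>. functionally_open X U) \<and> \<Union>\<U> = topspace X \<longrightarrow>
       (\<exists>\<V>. finite \<V> \<and> (\<forall>V\<in>\<V>. functionally_open X V \<and> (\<exists>U\<in>\<U>. V \<subseteq> U)) \<and>
            \<Union>\<V> = topspace X \<and> (\<forall>x\<in>topspace X. card {V\<in>\<V>. x \<in> V} \<le> n + 1)))"


section \<open>AE(0)-spaces\<close>

text \<open>The extension property for all test spaces \<open>Z\<close> whose points belong to the type \<open>'z\<close>.\<close>

definition AE0_wrt :: "'z itself \<Rightarrow> 'a topology \<Rightarrow> bool" where
  "AE0_wrt _ X \<longleftrightarrow>
     (\<forall>(Z :: 'z topology) Z\<^sub>0 f.
        Tychonoff_space Z \<and> covering_dim_le Z 0 \<and> Z\<^sub>0 \<subseteq> topspace Z \<and>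
        continuous_map (subtopology Z Z\<^sub>0) X f \<and>
        (\<forall>\<psi>. continuous_map X euclideanreal \<psi> \<longrightarrow>
           (\<exists>\<phi>. continuous_map Z euclideanreal \<phi> \<and> (\<forall>z\<in>Z\<^sub>0. \<phi> z = \<psi> (f z)))) \<longrightarrow>
        (\<exists>g. continuous_map Z X g \<and> (\<forall>z\<in>Z\<^sub>0. g z = f z)))"

text \<open>HOL cannot quantify over all types inside a definition. Nothing is lost by taking the test
  spaces from one type that is large enough relative to \<open>'a\<close>: the theorem \<open>AE0_space_universal\<close>
  at the end of this theory shows that an AE(0)-space has the extension property with respect to
  test spaces over every type.\<close>

definition AE0_space :: "'a topology \<Rightarrow> bool" where
  "AE0_space X \<longleftrightarrow> Tychonoff_space X \<and> AE0_wrt TYPE(('a \<Rightarrow> real) \<times> nat \<Rightarrow> nat) X"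


section \<open>Topological groups\<close>

definition topological_group :: "('a, 'b) monoid_scheme \<Rightarrow> 'a topology \<Rightarrow> bool" where
  "topological_group G T \<longleftrightarrow> group G \<and> topspace T = carrier G \<and>
     continuous_map (prod_topology T T) T (\<lambda>(x, y). x \<otimes>\<^bsub>G\<^esub> y) \<and>
     continuous_map T T (\<lambda>x. inv\<^bsub>G\<^esub> x)"

definition AE0_group :: "('a, 'b) monoid_scheme \<Rightarrow> 'a topology \<Rightarrow> bool" where
  "AE0_group G T \<longleftrightarrow> topological_group G T \<and> AE0_space T"

text \<open>The group \<open>S\<^sub>\<infinity>\<close> is the library's \<open>BijGroup (UNIV :: nat set)\<close>.\<close>

definition S_inf_topology :: "(nat \<Rightarrow> nat) topology" where
  "S_inf_topology =
     subtopology (product_topology (\<lambda>_. discrete_topology UNIV) UNIV) (Bij UNIV)"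

text \<open>The power \<open>S\<^sub>\<infinity>\<^sup>\<tau>\<close>, with the field of the cardinal order \<open>\<tau>\<close> as index set.\<close>

definition S_inf_power :: "'i rel \<Rightarrow> ('i \<Rightarrow> nat \<Rightarrow> nat) monoid" where
  "S_inf_power \<tau> = product_group (Field \<tau>) (\<lambda>_. BijGroup UNIV)"

definition S_inf_power_topology :: "'i rel \<Rightarrow> ('i \<Rightarrow> nat \<Rightarrow> nat) topology" where
  "S_inf_power_topology \<tau> = product_topology (\<lambda>_. S_inf_topology) (Field \<tau>)"

definition iso_closed_subgroup ::
  "('a, 'c) monoid_scheme \<Rightarrow> 'a topology \<Rightarrow> ('b, 'd) monoid_scheme \<Rightarrow> 'b topology \<Rightarrow> bool" where
  "iso_closed_subgroup G T P S \<longleftrightarrow>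
     (\<exists>H h. subgroup H P \<and> closedin S H \<and>
        h \<in> iso G (P\<lparr>carrier := H\<rparr>) \<and> homeomorphic_map T (subtopology S H) h)"

definition open_subgroup_basis_at_one :: "('a, 'c) monoid_scheme \<Rightarrow> 'a topology \<Rightarrow> bool" where
  "open_subgroup_basis_at_one G T \<longleftrightarrow>
     (\<exists>\<B>. (\<forall>H\<in>\<B>. subgroup H G \<and> openin T H) \<and>
        (\<forall>U. openin T U \<and> \<one>\<^bsub>G\<^esub> \<in> U \<longrightarrow> (\<exists>H\<in>\<B>. H \<subseteq> U)))"


section \<open>Independence of AE(0) from the type of test spaces\<close>

text \<open>Given \<open>f : Z\<^sub>0 \<rightarrow> X\<close> as in the definition, choose an extension to \<open>Z\<close> of \<open>\<psi> \<circ> f\<close> for each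
  \<open>\<psi>\<close> in \<open>C(X)\<close>. As \<open>dim Z \<le> 0\<close>, all of these factor through one map of \<open>Z\<close> to the power of the
  discrete space of natural numbers with exponent \<open>C(X) \<times> nat\<close>. That power is zero-dimensional, so
  the extension problem for \<open>Z\<close> reduces to one over the type used in \<open>AE0_space\<close>.\<close>

abbreviation nat_power :: "('b \<Rightarrow> nat) topology" where
  "nat_power \<equiv> product_topology (\<lambda>_. discrete_topology UNIV) UNIV"

lemma continuous_map_realI:
  fixes \<phi> :: "'a \<Rightarrow> real"
  assumes "\<And>x e. x \<in> topspace X \<Longrightarrow> e > 0 \<Longrightarrow>
     \<exists>U. openin X U \<and> x \<in> U \<and> (\<forall>y\<in>U. \<bar>\<phi> y - \<phi> x\<bar> < e)"
  shows "continuous_map X euclideanreal \<phi>"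
  unfolding continuous_map_def
proof (intro conjI allI impI)
  show "\<phi> \<in> topspace X \<rightarrow> topspace euclideanreal" by simp
  fix V assume "openin euclideanreal V"
  then have V: "open V" by simp
  show "openin X {x \<in> topspace X. \<phi> x \<in> V}"
  proof (subst openin_subopen, intro ballI)
    fix x assume "x \<in> {x \<in> topspace X. \<phi> x \<in> V}"
    then have x: "x \<in> topspace X" "\<phi> x \<in> V" by auto
    obtain e where e: "e > 0" "\<And>y. dist y (\<phi> x) < e \<Longrightarrow> y \<in> V"
      using V x(2) unfolding open_dist by blast
    obtain U where U: "openin X U" "x \<in> U" "\<forall>y\<in>U. \<bar>\<phi> y - \<phi> x\<bar> < e"
      using assms[OF x(1) e(1)] by blast
    have "U \<subseteq> {x \<in> topspace X. \<phi> x \<in> V}"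
      using U openin_subset[OF U(1)] e(2) by (auto simp: dist_real_def)
    then show "\<exists>T. openin X T \<and> x \<in> T \<and> T \<subseteq> {x \<in> topspace X. \<phi> x \<in> V}"
      using U by blast
  qed
qed

lemma functionally_open_openin:
  assumes "functionally_open X U" shows "openin X U"
proof -
  obtain \<phi> where p: "continuous_map X euclideanreal \<phi>" "U = {x \<in> topspace X. \<phi> x \<noteq> 0}"
    using assms by (auto simp: functionally_open_def)
  have "openin X {x \<in> topspace X. \<phi> x \<in> - {0}}"
    by (rule openin_continuous_map_preimage[OF p(1)]) (simp add: open_Compl)
  then show ?thesis using p by simp
qed

lemma functionally_open_clopen:
  assumes "openin X U" "closedin X U" shows "functionally_open X U"
proof -
  define \<phi> :: "_ \<Rightarrow> real" where "\<phi> = (\<lambda>x. if x \<in> U then 1 else 0)"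
  have "continuous_map X euclideanreal \<phi>"
  proof (rule continuous_map_realI)
    fix x and e :: real assume x: "x \<in> topspace X" "e > 0"
    show "\<exists>V. openin X V \<and> x \<in> V \<and> (\<forall>y\<in>V. \<bar>\<phi> y - \<phi> x\<bar> < e)"
    proof (cases "x \<in> U")
      case True
      then show ?thesis using assms x by (intro exI[of _ U]) (auto simp: \<phi>_def)
    next
      case False
      then show ?thesis using assms x by (intro exI[of _ "topspace X - U"]) (auto simp: \<phi>_def)
    qed
  qed
  moreover have "U = {x \<in> topspace X. \<phi> x \<noteq> 0}"
    using openin_subset[OF assms(1)] by (auto simp: \<phi>_def)
  ultimately show ?thesis by (auto simp: functionally_open_def)
qed

lemma openin_Least:
  fixes b :: "nat \<Rightarrow> 'a set"
  assumes "\<And>n. openin X (b n)" "\<And>n. closedin X (b n)" "topspace X \<subseteq> (\<Union>n. b n)"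
  shows "openin X {x \<in> topspace X. P (LEAST n. x \<in> b n)}"
proof (subst openin_subopen, intro ballI)
  fix x assume "x \<in> {x \<in> topspace X. P (LEAST n. x \<in> b n)}"
  then have x: "x \<in> topspace X" "P (LEAST n. x \<in> b n)" by auto
  define N where "N = (LEAST n. x \<in> b n)"
  have ex: "\<exists>n. x \<in> b n" using assms(3) x by auto
  have N: "x \<in> b N" unfolding N_def using ex by (rule LeastI_ex)
  have nN: "x \<notin> b m" if "m < N" for m using that unfolding N_def by (rule not_less_Least)
  define W where "W = b N - (\<Union>m<N. b m)"
  have "closedin X (\<Union>m<N. b m)" using assms(2) by (intro closedin_Union) auto
  then have W: "openin X W" unfolding W_def using assms(1) by (intro openin_diff) auto
  have "(LEAST n. y \<in> b n) = N" if "y \<in> W" for y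
  proof (rule Least_equality)
    show "y \<in> b N" using that by (simp add: W_def)
    show "N \<le> m" if "y \<in> b m" for m
      using that \<open>y \<in> W\<close> by (cases "m < N") (auto simp: W_def)
  qed
  then have "W \<subseteq> {x \<in> topspace X. P (LEAST n. x \<in> b n)}"
    using openin_subset[OF W] x(2) by (auto simp: N_def[symmetric])
  moreover have "x \<in> W" using N nN by (auto simp: W_def)
  ultimately show "\<exists>T. openin X T \<and> x \<in> T \<and> T \<subseteq> {x \<in> topspace X. P (LEAST n. x \<in> b n)}"
    using W by blast
qed

subsection \<open>Powers of the discrete space of natural numbers have dimension zero\<close>

definition cyl :: "'b set \<Rightarrow> ('b \<Rightarrow> nat) \<Rightarrow> ('b \<Rightarrow> nat) set" where
  "cyl C s = {x. \<forall>i\<in>C. x i = s i}"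

definition supported :: "'b set \<Rightarrow> ('b \<Rightarrow> nat) set \<Rightarrow> bool" where
  "supported D U \<longleftrightarrow> (\<forall>x y. (\<forall>i\<in>D. x i = y i) \<longrightarrow> x \<in> U \<longrightarrow> y \<in> U)"

lemma topspace_nat_power [simp]: "topspace nat_power = UNIV"
  by simp

lemma closedin_nat_power: "openin nat_power U \<Longrightarrow> closedin nat_power (UNIV - U)"
  using closedin_def[of nat_power "UNIV - U"] by (simp add: double_diff)

lemma continuous_map_coord: "continuous_map nat_power (discrete_topology UNIV) (\<lambda>x. x i)"
  by (rule continuous_map_product_projection) simp

lemma openin_coord: "openin nat_power {x. P (x i)}"
proof -
  have "openin nat_power {x \<in> topspace nat_power. x i \<in> {k. P k}}"
    by (rule openin_continuous_map_preimage[OF continuous_map_coord]) simp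
  then show ?thesis by simp
qed

lemma cyl_clopen:
  assumes "finite C" shows "openin nat_power (cyl C s)" "closedin nat_power (cyl C s)"
proof -
  have eq: "cyl C s = UNIV - (\<Union>i\<in>C. {x. x i \<noteq> s i})" by (auto simp: cyl_def)
  have "openin nat_power (\<Union>i\<in>C. {x. x i \<noteq> s i})"
    by (intro openin_Union) (auto intro: openin_coord)
  then show "closedin nat_power (cyl C s)"
    unfolding eq by (rule closedin_nat_power)
  have "closedin nat_power (\<Union>i\<in>C. {x. x i \<noteq> s i})"
  proof (rule closedin_Union)
    show "finite ((\<lambda>i. {x. x i \<noteq> s i}) ` C)" using assms by simp
    fix S assume "S \<in> (\<lambda>i. {x. x i \<noteq> s i}) ` C"
    then obtain i where "S = UNIV - {x. x i = s i}" by auto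
    then show "closedin nat_power S" using closedin_nat_power[OF openin_coord[of "\<lambda>k. k = s i" i]]
      by simp
  qed
  then show "openin nat_power (cyl C s)" unfolding eq
    using openin_diff[OF openin_topspace, of nat_power] by simp
qed

lemma open_cyl:
  assumes "openin nat_power U" "x \<in> U"
  obtains C where "finite C" "cyl C x \<subseteq> U"
proof -
  obtain V where V: "finite {i. V i \<noteq> UNIV}" "x \<in> Pi\<^sub>E UNIV V" "Pi\<^sub>E UNIV V \<subseteq> U"
    using assms unfolding openin_product_topology_alt by fastforce
  have "cyl {i. V i \<noteq> UNIV} x \<subseteq> U"
  proof
    fix y assume y: "y \<in> cyl {i. V i \<noteq> UNIV} x"
    have "y i \<in> V i" for i
      using y V(2) by (cases "V i = UNIV") (auto simp: cyl_def PiE_iff)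
    then show "y \<in> U" using V(3) by (auto simp: PiE_iff)
  qed
  then show ?thesis using that V(1) by blast
qed

lemma supported_closure:
  fixes U :: "('b \<Rightarrow> nat) set"
  assumes "openin nat_power U"
  shows "\<exists>D. countable D \<and> supported D (nat_power closure_of U)"
proof -
  define good where "good = (\<lambda>C (s :: 'b \<Rightarrow> nat) C'. finite C' \<and>
     (\<exists>s'. cyl C' s' \<subseteq> U \<and> cyl C s \<inter> cyl C' s' \<noteq> {}))"
  have good_ex: "\<exists>C'. good C s C'" if ne: "cyl C s \<inter> U \<noteq> {}" for C s
  proof -
    obtain x where "x \<in> cyl C s" "x \<in> U" using ne by auto
    moreover obtain C' where "finite C'" "cyl C' x \<subseteq> U" using open_cyl[OF assms \<open>x \<in> U\<close>] .
    moreover have "x \<in> cyl C' x" by (simp add: cyl_def)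
    ultimately show ?thesis unfolding good_def by blast
  qed
  define p where "p = (\<lambda>C s. if \<exists>C'. good C s C' then SOME C'. good C s C' else {})"
  have p_fin: "finite (p C s)" for C s
  proof (cases "\<exists>C'. good C s C'")
    case True
    then have "good C s (SOME C'. good C s C')" by (rule someI_ex)
    then have "finite (SOME C'. good C s C')" unfolding good_def by blast
    then show ?thesis using True by (simp only: p_def if_True)
  next
    case False
    then show ?thesis by (simp only: p_def if_False finite.emptyI)
  qed
  have p_good: "good C s (p C s)" if "cyl C s \<inter> U \<noteq> {}" for C s
    using someI_ex[OF good_ex[OF that]] good_ex[OF that] by (simp only: p_def if_True)
  define step where "step = (\<lambda>D. D \<union>
     (\<Union>(C, s)\<in>(SIGMA C:{C. finite C \<and> C \<subseteq> D}. (\<Pi>\<^sub>E i\<in>C. UNIV)). p C s))"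
  have step_count: "countable (step D)" if "countable D" for D
  proof -
    have "countable (SIGMA C:{C. finite C \<and> C \<subseteq> D}. (\<Pi>\<^sub>E i\<in>C. UNIV :: nat set))"
      by (intro countable_SIGMA countable_Collect_finite_subset[OF that] countable_PiE) simp_all
    then have "countable (\<Union>(C, s)\<in>(SIGMA C:{C. finite C \<and> C \<subseteq> D}. (\<Pi>\<^sub>E i\<in>C. UNIV)). p C s)"
      by (rule countable_UN) (simp add: case_prod_unfold countable_finite p_fin)
    then show ?thesis unfolding step_def using that by (rule countable_Un[rotated])
  qed
  define Dn where "Dn = (\<lambda>n. (step ^^ n) {})"
  define D where "D = (\<Union>n. Dn n)"
  have "countable (Dn n)" for n by (induction n) (auto simp: Dn_def step_count)
  then have D_count: "countable D" by (simp add: D_def)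
  have Dn_Suc: "Dn (Suc n) = step (Dn n)" for n by (simp add: Dn_def)
  have "Dn n \<subseteq> Dn (Suc n)" for n unfolding Dn_Suc by (auto simp: step_def)
  then have mono: "Dn m \<subseteq> Dn n" if "m \<le> n" for m n using that by (rule lift_Suc_mono_le)
  have fin_sub: "\<exists>n. C \<subseteq> Dn n" if "finite C" "C \<subseteq> D" for C
    using that
  proof (induction C rule: finite_induct)
    case (insert c C)
    then obtain n m where "C \<subseteq> Dn n" "c \<in> Dn m" by (auto simp: D_def)
    then show ?case using mono[of n "max n m"] mono[of m "max n m"]
      by (intro exI[of _ "max n m"]) auto
  qed auto
  have "x \<in> nat_power closure_of U"
    if agree: "\<forall>i\<in>D. y i = x i" and y: "y \<in> nat_power closure_of U" for x y
    unfolding in_closure_of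
  proof (intro conjI allI impI)
    show "x \<in> topspace nat_power" by simp
    fix T assume "x \<in> T \<and> openin nat_power T"
    then obtain E where E: "finite E" "cyl E x \<subseteq> T" using open_cyl by blast
    define C where "C = E \<inter> D"
    have C: "finite C" "C \<subseteq> D" using E by (auto simp: C_def)
    define s where "s = restrict y C"
    have bs: "cyl C s = cyl C y" by (auto simp: cyl_def s_def)
    have "openin nat_power (cyl C y)" "y \<in> cyl C y" using cyl_clopen[OF C(1)] by (auto simp: cyl_def)
    then have "cyl C s \<inter> U \<noteq> {}" using y unfolding in_closure_of bs by blast
    then have "good C s (p C s)" by (rule p_good)
    then obtain s' where s': "cyl (p C s) s' \<subseteq> U" "cyl C s \<inter> cyl (p C s) s' \<noteq> {}"
      by (auto simp: good_def)
    obtain n where n: "C \<subseteq> Dn n" using fin_sub[OF C] by blast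
    have "s \<in> (\<Pi>\<^sub>E i\<in>C. UNIV)" by (auto simp: s_def)
    then have "(C, s) \<in> (SIGMA C:{C. finite C \<and> C \<subseteq> Dn n}. (\<Pi>\<^sub>E i\<in>C. UNIV))"
      using n C(1) by simp
    then have "p C s \<subseteq> Dn (Suc n)" unfolding Dn_Suc step_def
      using UN_upper[of "(C, s)" _ "\<lambda>(C, s). p C s"] by (intro le_supI2) simp
    then have pD: "p C s \<subseteq> D" by (auto simp: D_def)
    define w where "w = (\<lambda>i. if i \<in> p C s then s' i else x i)"
    have "w \<in> cyl (p C s) s'" by (auto simp: w_def cyl_def)
    moreover have "w \<in> cyl E x"
    proof -
      have "s' i = x i" if i: "i \<in> E" "i \<in> p C s" for i
      proof -
        have iC: "i \<in> C" using i pD by (auto simp: C_def)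
        obtain v where v: "v \<in> cyl C s" "v \<in> cyl (p C s) s'" using s'(2) by auto
        then have "s' i = s i" using i iC by (auto simp: cyl_def)
        also have "\<dots> = x i" using agree iC C by (auto simp: s_def)
        finally show ?thesis .
      qed
      then show ?thesis by (auto simp: w_def cyl_def)
    qed
    ultimately show "\<exists>y. y \<in> U \<and> y \<in> T" using s'(1) E(2) by blast
  qed
  then have "supported D (nat_power closure_of U)" unfolding supported_def by blast
  then show ?thesis using D_count by blast
qed

lemma supported_functionally_open:
  fixes U :: "('b \<Rightarrow> nat) set"
  assumes "functionally_open nat_power U"
  shows "\<exists>D. countable D \<and> supported D U"
proof -
  obtain \<phi> where p: "continuous_map nat_power euclideanreal \<phi>" "U = {x. \<phi> x \<noteq> 0}"
    using assms by (auto simp: functionally_open_def)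
  define W where "W = (\<lambda>n. {x. \<bar>\<phi> x\<bar> > inverse (real (Suc n))})"
  have Wo: "openin nat_power (W n)" for n
  proof -
    have "openin nat_power {x \<in> topspace nat_power. \<phi> x \<in> {r. \<bar>r\<bar> > inverse (real (Suc n))}}"
      by (rule openin_continuous_map_preimage[OF p(1)])
        (simp, intro open_Collect_less continuous_intros)
    then show ?thesis by (simp add: W_def)
  qed
  have cl: "nat_power closure_of W n \<subseteq> U" for n
  proof -
    have "closedin nat_power {x \<in> topspace nat_power. \<phi> x \<in> {r. inverse (real (Suc n)) \<le> \<bar>r\<bar>}}"
      by (rule closedin_continuous_map_preimage[OF p(1)])
        (simp, intro closed_Collect_le continuous_intros)
    then have "nat_power closure_of W n \<subseteq> {x \<in> topspace nat_power. \<phi> x \<in> {r. inverse (real (Suc n)) \<le> \<bar>r\<bar>}}"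
      by (intro closure_of_minimal) (auto simp: W_def)
    also have "\<dots> \<subseteq> U" unfolding p(2)
    proof safe
      fix x assume "inverse (real (Suc n)) \<le> \<bar>\<phi> x\<bar>" "\<phi> x = 0"
      moreover have "inverse (real (Suc n)) > 0" by simp
      ultimately show False by linarith
    qed
    finally show ?thesis .
  qed
  have UW: "U = (\<Union>n. nat_power closure_of W n)"
  proof
    show "(\<Union>n. nat_power closure_of W n) \<subseteq> U" using cl by blast
    show "U \<subseteq> (\<Union>n. nat_power closure_of W n)"
    proof
      fix x assume "x \<in> U"
      then have "\<bar>\<phi> x\<bar> > 0" by (simp add: p(2))
      then obtain n where "inverse (real (Suc n)) < \<bar>\<phi> x\<bar>" using reals_Archimedean by blast
      then have "x \<in> W n" by (simp add: W_def)
      then show "x \<in> (\<Union>n. nat_power closure_of W n)"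
        using closure_of_subset[of "W n" nat_power] by auto
    qed
  qed
  obtain D where D: "\<And>n. countable (D n)" "\<And>n. supported (D n) (nat_power closure_of W n)"
    using supported_closure[OF Wo] by metis
  have "supported (\<Union>n. D n) U"
    unfolding supported_def
  proof (intro allI impI)
    fix x y assume a: "\<forall>i\<in>\<Union>n. D n. x i = y i" "x \<in> U"
    then obtain n where n: "x \<in> nat_power closure_of W n" using UW by blast
    have "\<forall>i\<in>D n. x i = y i" using a(1) by blast
    then have "y \<in> nat_power closure_of W n" using D(2)[of n] n unfolding supported_def by blast
    then show "y \<in> U" using UW by blast
  qed
  then show ?thesis using D(1) by (intro exI[of _ "\<Union>n. D n"]) auto
qed

lemma covering_dim_nat_power: "covering_dim_le (nat_power :: ('b \<Rightarrow> nat) topology) 0"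
  unfolding covering_dim_le_def
proof (intro allI impI, elim conjE)
  fix \<U> :: "('b \<Rightarrow> nat) set set"
  assume fin: "finite \<U>" and fo: "\<forall>U\<in>\<U>. functionally_open nat_power U"
    and cov: "\<Union>\<U> = topspace nat_power"
  obtain D' where D': "\<And>U. U \<in> \<U> \<Longrightarrow> countable (D' U) \<and> supported (D' U) U"
    using supported_functionally_open fo by metis
  define D where "D = (\<Union>U\<in>\<U>. D' U)"
  have D: "countable D" unfolding D_def using fin D' by (intro countable_UN) (auto intro: countable_finite)
  have sup: "supported D U" if "U \<in> \<U>" for U
  proof -
    have "D' U \<subseteq> D" using that by (auto simp: D_def)
    then show ?thesis using D'[OF that] unfolding supported_def by blast
  qed
  define \<B> where "\<B> = {B. (\<exists>C s. finite C \<and> C \<subseteq> D \<and> s \<in> (\<Pi>\<^sub>E i\<in>C. UNIV) \<and> B = cyl C s) \<and> (\<exists>U\<in>\<U>. B \<subseteq> U)}"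
  have "countable ((\<lambda>(C, s). cyl C s) ` (SIGMA C:{C. finite C \<and> C \<subseteq> D}. (\<Pi>\<^sub>E i\<in>C. UNIV)))"
    by (intro countable_image countable_SIGMA countable_Collect_finite_subset[OF D] countable_PiE) auto
  then have cB: "countable \<B>" by (rule countable_subset[rotated]) (auto simp: \<B>_def)
  have covB: "\<exists>B\<in>\<B>. x \<in> B" for x
  proof -
    have "x \<in> \<Union>\<U>" unfolding cov by simp
    then obtain U where U: "U \<in> \<U>" "x \<in> U" by blast
    obtain C where C: "finite C" "cyl C x \<subseteq> U"
      using open_cyl[OF functionally_open_openin U(2)] fo U(1) by blast
    have "cyl (C \<inter> D) x \<subseteq> U"
    proof
      fix y assume y: "y \<in> cyl (C \<inter> D) x"
      define z where "z = (\<lambda>i. if i \<in> D then y i else x i)"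
      have "z \<in> cyl C x" using y by (auto simp: cyl_def z_def)
      then have "z \<in> U" using C by blast
      moreover have "\<forall>i\<in>D. z i = y i" by (simp add: z_def)
      ultimately show "y \<in> U" using sup[OF U(1)] unfolding supported_def by blast
    qed
    moreover have "cyl (C \<inter> D) x = cyl (C \<inter> D) (restrict x (C \<inter> D))" by (auto simp: cyl_def)
    moreover have "restrict x (C \<inter> D) \<in> (\<Pi>\<^sub>E i\<in>C \<inter> D. UNIV)" by simp
    ultimately have "cyl (C \<inter> D) x \<in> \<B>" unfolding \<B>_def mem_Collect_eq
      using C(1) U(1)
      by (intro conjI exI[of _ "C \<inter> D"] exI[of _ "restrict x (C \<inter> D)"] bexI[of _ U]) simp_all
    moreover have "x \<in> cyl (C \<inter> D) x" by (simp add: cyl_def)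
    ultimately show ?thesis by blast
  qed
  then have "\<B> \<noteq> {}" by blast
  define b where "b = from_nat_into \<B>"
  have rb: "range b = \<B>" unfolding b_def using \<open>\<B> \<noteq> {}\<close> cB by (rule range_from_nat_into)
  have bB: "b n \<in> \<B>" for n using rb by blast
  have bo: "openin nat_power (b n)" "closedin nat_power (b n)" for n
  proof -
    obtain C s where "finite C" "b n = cyl C s" using bB[of n] unfolding \<B>_def by blast
    then show "openin nat_power (b n)" "closedin nat_power (b n)" using cyl_clopen[of C s] by simp_all
  qed
  have bc: "topspace nat_power \<subseteq> (\<Union>n. b n)" using covB rb by auto
  define u where "u = (\<lambda>B. SOME U. U \<in> \<U> \<and> B \<subseteq> U)"
  have u: "u B \<in> \<U> \<and> B \<subseteq> u B" if "B \<in> \<B>" for B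
  proof -
    have "\<exists>U. U \<in> \<U> \<and> B \<subseteq> U" using that unfolding \<B>_def by blast
    then show ?thesis unfolding u_def by (rule someI_ex)
  qed
  define V where "V = (\<lambda>U. {x. u (b (LEAST n. x \<in> b n)) = U})"
  have Vo: "openin nat_power (V U)" for U
    using openin_Least[OF bo bc, of "\<lambda>n. u (b n) = U"] by (simp add: V_def)
  have Vo': "openin nat_power (- V U)" for U
    using openin_Least[OF bo bc, of "\<lambda>n. u (b n) \<noteq> U"]
    by (simp add: V_def Collect_neg_eq)
  have Vc: "closedin nat_power (V U)" for U
    using Vo'[of U] by (simp add: closedin_def Compl_eq_Diff_UNIV)
  have least: "x \<in> b (LEAST n. x \<in> b n)" for x
  proof -
    have "x \<in> (\<Union>n. b n)" using bc by auto
    then have "\<exists>n. x \<in> b n" by blast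
    then show ?thesis by (rule LeastI_ex)
  qed
  have VU: "V U \<subseteq> U" for U
  proof
    fix x assume "x \<in> V U"
    then have "u (b (LEAST n. x \<in> b n)) = U" by (simp add: V_def)
    then show "x \<in> U" using least[of x] u[OF bB] by blast
  qed
  show "\<exists>\<V>. finite \<V> \<and> (\<forall>V\<in>\<V>. functionally_open nat_power V \<and> (\<exists>U\<in>\<U>. V \<subseteq> U)) \<and>
     \<Union>\<V> = topspace nat_power \<and> (\<forall>x\<in>topspace nat_power. card {V\<in>\<V>. x \<in> V} \<le> 0 + 1)"
  proof (intro exI[of _ "V ` \<U>"] conjI ballI)
    show "finite (V ` \<U>)" using fin by simp
    fix W assume "W \<in> V ` \<U>"
    then show "functionally_open nat_power W" "\<exists>U\<in>\<U>. W \<subseteq> U"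
      using functionally_open_clopen[OF Vo Vc] VU by auto
  next
    have "x \<in> V (u (b (LEAST n. x \<in> b n)))" for x by (simp add: V_def)
    then have "x \<in> \<Union> (V ` \<U>)" for x using u[OF bB] by blast
    then show "\<Union> (V ` \<U>) = topspace nat_power" by auto
  next
    fix x
    have "{W \<in> V ` \<U>. x \<in> W} \<subseteq> {V (u (b (LEAST n. x \<in> b n)))}" by (auto simp: V_def)
    then have "card {W \<in> V ` \<U>. x \<in> W} \<le> card {V (u (b (LEAST n. x \<in> b n)))}"
      by (intro card_mono) auto
    then show "card {W \<in> V ` \<U>. x \<in> W} \<le> 0 + 1" by simp
  qed
qed

lemma Tychonoff_nat_power: "Tychonoff_space nat_power"
  unfolding Tychonoff_space_def
  by (auto simp: completely_regular_space_product_topology Hausdorff_space_product_topology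
      intro: completely_regular_space_discrete_topology)

subsection \<open>Maps from zero-dimensional spaces factor through powers of the natural numbers\<close>

lemma clopen_between:
  fixes \<phi> \<eta> :: "'a \<Rightarrow> real"
  assumes dim: "covering_dim_le Z 0"
    and phi: "continuous_map Z euclideanreal \<phi>" and chi: "continuous_map Z euclideanreal \<eta>"
    and disj: "\<And>z. z \<in> topspace Z \<Longrightarrow> \<eta> z = 0 \<Longrightarrow> \<phi> z \<noteq> 0"
  shows "\<exists>W. openin Z W \<and> closedin Z W \<and> {z \<in> topspace Z. \<eta> z = 0} \<subseteq> W \<and> W \<subseteq> {z \<in> topspace Z. \<phi> z \<noteq> 0}"
proof -
  define U where "U = {z \<in> topspace Z. \<phi> z \<noteq> 0}"
  define F where "F = {z \<in> topspace Z. \<eta> z \<noteq> 0}"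
  have "finite {U, F} \<and> (\<forall>A\<in>{U, F}. functionally_open Z A) \<and> \<Union>{U, F} = topspace Z"
    using phi chi disj by (auto simp: U_def F_def functionally_open_def)
  then obtain \<V> where V: "finite \<V>" "\<forall>V\<in>\<V>. functionally_open Z V \<and> (\<exists>A\<in>{U, F}. V \<subseteq> A)"
      "\<Union>\<V> = topspace Z" "\<forall>x\<in>topspace Z. card {V\<in>\<V>. x \<in> V} \<le> 0 + 1"
    using dim[unfolded covering_dim_le_def, THEN spec, of "{U, F}"] by (elim impE exE conjE) auto
  have uniq: "A = B" if "A \<in> \<V>" "B \<in> \<V>" "x \<in> A" "x \<in> B" for A B x
  proof -
    have "card {V\<in>\<V>. x \<in> V} \<le> Suc 0" using V(3,4) that by auto
    moreover have "finite {V\<in>\<V>. x \<in> V}" using V(1) by simp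
    ultimately show ?thesis using that by (auto simp: card_le_Suc0_iff_eq)
  qed
  define W where "W = \<Union>{V\<in>\<V>. V \<subseteq> U}"
  define W' where "W' = \<Union>{V\<in>\<V>. \<not> V \<subseteq> U}"
  have o: "openin Z W" "openin Z W'"
    unfolding W_def W'_def using V(2) functionally_open_openin by (auto intro!: openin_Union)
  have "W = topspace Z - W'"
  proof
    show "W \<subseteq> topspace Z - W'"
    proof
      fix x assume "x \<in> W"
      then obtain A where A: "A \<in> \<V>" "A \<subseteq> U" "x \<in> A" by (auto simp: W_def)
      have "x \<notin> W'"
      proof
        assume "x \<in> W'"
        then obtain B where "B \<in> \<V>" "\<not> B \<subseteq> U" "x \<in> B" by (auto simp: W'_def)
        then show False using A uniq[of A B x] by simp
      qed
      then show "x \<in> topspace Z - W'" using A V(3) by auto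
    qed
    show "topspace Z - W' \<subseteq> W" unfolding W_def W'_def V(3)[symmetric] by blast
  qed
  then have "closedin Z W" using o(2) by auto
  moreover have "topspace Z - F \<subseteq> W"
  proof
    fix z assume z: "z \<in> topspace Z - F"
    then obtain A where "A \<in> \<V>" "z \<in> A" using V(3) by auto
    then show "z \<in> W" using V(2) z unfolding W_def by blast
  qed
  moreover have "W \<subseteq> U" by (auto simp: W_def)
  ultimately show ?thesis using o(1) unfolding U_def F_def by (intro exI[of _ W]) auto
qed

lemma approx_locally_constant:
  fixes \<phi> :: "'a \<Rightarrow> real"
  assumes dim: "covering_dim_le Z 0" and phi: "continuous_map Z euclideanreal \<phi>" and e: "e > 0"
  shows "\<exists>c :: 'a \<Rightarrow> nat. continuous_map Z (discrete_topology UNIV) c \<and>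
     (\<forall>z\<in>topspace Z. \<bar>\<phi> z - e * of_int (int_decode (c z))\<bar> < 2 * e)"
proof -
  have "\<exists>W. openin Z W \<and> closedin Z W \<and> {z \<in> topspace Z. \<bar>\<phi> z - e * of_int k\<bar> \<le> e} \<subseteq> W \<and>
     W \<subseteq> {z \<in> topspace Z. \<bar>\<phi> z - e * of_int k\<bar> < 2 * e}" for k
  proof -
    define \<alpha> where "\<alpha> = (\<lambda>z. max (2 * e - \<bar>\<phi> z - e * of_int k\<bar>) 0)"
    define \<beta> where "\<beta> = (\<lambda>z. max (\<bar>\<phi> z - e * of_int k\<bar> - e) 0)"
    have "continuous_map Z euclideanreal \<alpha>" "continuous_map Z euclideanreal \<beta>"
      unfolding \<alpha>_def \<beta>_def by (intro continuous_intros phi)+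
    then have *: "\<exists>W. openin Z W \<and> closedin Z W \<and> {z \<in> topspace Z. \<beta> z = 0} \<subseteq> W \<and> W \<subseteq> {z \<in> topspace Z. \<alpha> z \<noteq> 0}"
      using e by (intro clopen_between[OF dim]) (auto simp: \<alpha>_def \<beta>_def)
    have \<beta>: "{z \<in> topspace Z. \<beta> z = 0} = {z \<in> topspace Z. \<bar>\<phi> z - e * of_int k\<bar> \<le> e}"
      by (auto simp: \<beta>_def max_def)
    have \<alpha>: "{z \<in> topspace Z. \<alpha> z \<noteq> 0} = {z \<in> topspace Z. \<bar>\<phi> z - e * of_int k\<bar> < 2 * e}"
      by (auto simp: \<alpha>_def max_def)
    show ?thesis using * unfolding \<alpha> \<beta> .
  qed
  then have "\<forall>k. \<exists>W. openin Z W \<and> closedin Z W \<and> {z \<in> topspace Z. \<bar>\<phi> z - e * of_int k\<bar> \<le> e} \<subseteq> W \<and>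
     W \<subseteq> {z \<in> topspace Z. \<bar>\<phi> z - e * of_int k\<bar> < 2 * e}" by (rule allI)
  from choice[OF this] obtain W where
    "\<forall>k. openin Z (W k) \<and> closedin Z (W k) \<and> {z \<in> topspace Z. \<bar>\<phi> z - e * of_int k\<bar> \<le> e} \<subseteq> W k \<and>
     W k \<subseteq> {z \<in> topspace Z. \<bar>\<phi> z - e * of_int k\<bar> < 2 * e}" ..
  then have W: "\<And>k. openin Z (W k)" "\<And>k. closedin Z (W k)"
     "\<And>k. {z \<in> topspace Z. \<bar>\<phi> z - e * of_int k\<bar> \<le> e} \<subseteq> W k"
     "\<And>k. W k \<subseteq> {z \<in> topspace Z. \<bar>\<phi> z - e * of_int k\<bar> < 2 * e}"
    by (simp_all only:)
  define b where "b = (\<lambda>n. W (int_decode n))"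
  have cov: "topspace Z \<subseteq> (\<Union>n. b n)"
  proof
    fix z assume z: "z \<in> topspace Z"
    define k where "k = \<lfloor>\<phi> z / e\<rfloor>"
    have "of_int k \<le> \<phi> z / e" "\<phi> z / e < of_int k + 1" unfolding k_def by linarith+
    then have "e * of_int k \<le> \<phi> z" "\<phi> z < e * of_int k + e" using e by (auto simp: field_simps)
    then have "\<bar>\<phi> z - e * of_int k\<bar> \<le> e" by linarith
    then have "z \<in> W k" using W(3) z by blast
    then have "z \<in> b (int_encode k)" by (simp add: b_def)
    then show "z \<in> (\<Union>n. b n)" by blast
  qed
  define c where "c = (\<lambda>z. LEAST n. z \<in> b n)"
  have "openin Z {z \<in> topspace Z. c z \<in> A}" for A
    unfolding c_def by (rule openin_Least) (use cov W in \<open>auto simp: b_def\<close>)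
  then have "continuous_map Z (discrete_topology UNIV) c" by (simp add: continuous_map_def)
  moreover have "\<bar>\<phi> z - e * of_int (int_decode (c z))\<bar> < 2 * e" if "z \<in> topspace Z" for z
  proof -
    have "z \<in> b (c z)" unfolding c_def by (rule LeastI_ex) (use cov that in auto)
    then show ?thesis using W(4) unfolding b_def by blast
  qed
  ultimately show ?thesis by blast
qed

text \<open>Decoding a sequence of approximations; steps that are too large are ignored, so that the
  limit exists for every sequence.\<close>

primrec partial_decode :: "(nat \<Rightarrow> nat) \<Rightarrow> nat \<Rightarrow> real" where
  "partial_decode s 0 = of_int (int_decode (s 0))"
| "partial_decode s (Suc n) =
     (let r = (1/2) ^ Suc n * of_int (int_decode (s (Suc n))) in
      if \<bar>r - partial_decode s n\<bar> \<le> 4 * (1/2) ^ n then r else partial_decode s n)"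

definition decode :: "(nat \<Rightarrow> nat) \<Rightarrow> real" where
  "decode s = lim (partial_decode s)"

lemma partial_decode_step: "\<bar>partial_decode s (Suc n) - partial_decode s n\<bar> \<le> 4 * (1/2) ^ n"
  by (simp add: Let_def)

lemma partial_decode_diff:
  "\<bar>partial_decode s (n + m) - partial_decode s n\<bar> \<le> 8 * (1/2) ^ n - 8 * (1/2) ^ (n + m)"
proof (induction m)
  case (Suc m)
  have "(1/2::real) ^ (n + Suc m) = (1/2) ^ (n + m) / 2" by simp
  then show ?case using Suc partial_decode_step[of s "n + m"] by simp
qed simp

lemma partial_decode_diff': "\<bar>partial_decode s (n + m) - partial_decode s n\<bar> \<le> 8 * (1/2) ^ n"
proof -
  have "(1/2::real) ^ (n + m) \<ge> 0" by simp
  then show ?thesis using partial_decode_diff[of s n m] by linarith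
qed

lemma partial_decode_lim: "partial_decode s \<longlonglongrightarrow> decode s"
proof -
  have "summable (\<lambda>n. partial_decode s (Suc n) - partial_decode s n)"
  proof (rule summable_comparison_test)
    show "\<exists>N. \<forall>n\<ge>N. norm (partial_decode s (Suc n) - partial_decode s n) \<le> 4 * (1/2) ^ n"
      using partial_decode_step by (metis real_norm_def)
    show "summable (\<lambda>n. 4 * (1/2::real) ^ n)" by (intro summable_mult summable_geometric) simp
  qed
  then have "convergent (\<lambda>n. \<Sum>k<n. partial_decode s (Suc k) - partial_decode s k)"
    by (simp add: summable_iff_convergent)
  then have "convergent (\<lambda>n. partial_decode s n - partial_decode s 0)"
    by (simp only: sum_lessThan_telescope)
  then have "convergent (\<lambda>n. (partial_decode s n - partial_decode s 0) + partial_decode s 0)"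
    by (rule convergent_add[OF _ convergent_const])
  then have "convergent (partial_decode s)" by simp
  then show ?thesis unfolding decode_def by (rule convergent_LIMSEQ_iff[THEN iffD1])
qed

lemma decode_approx: "\<bar>decode s - partial_decode s n\<bar> \<le> 8 * (1/2) ^ n"
proof (rule LIMSEQ_le_const2)
  show "(\<lambda>m. \<bar>partial_decode s (m + n) - partial_decode s n\<bar>) \<longlonglongrightarrow> \<bar>decode s - partial_decode s n\<bar>"
    by (intro tendsto_intros LIMSEQ_ignore_initial_segment partial_decode_lim)
  show "\<exists>N. \<forall>m\<ge>N. \<bar>partial_decode s (m + n) - partial_decode s n\<bar> \<le> 8 * (1/2) ^ n"
    using partial_decode_diff'[of s n] by (metis add.commute)
qed

lemma partial_decode_cong: "(\<And>i. i \<le> n \<Longrightarrow> s i = s' i) \<Longrightarrow> partial_decode s n = partial_decode s' n"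
  by (induction n) (auto simp: Let_def)

lemma decode_eq:
  assumes "\<And>n. \<bar>r - (1/2) ^ n * of_int (int_decode (s n))\<bar> < 2 * (1/2) ^ n"
  shows "decode s = r"
proof -
  have pd: "partial_decode s n = (1/2) ^ n * of_int (int_decode (s n))" for n
  proof (induction n)
    case (Suc n)
    have "(1/2::real) ^ Suc n = (1/2) ^ n / 2" "(0::real) < (1/2) ^ n" by simp_all
    then have "\<bar>(1/2::real) ^ Suc n * of_int (int_decode (s (Suc n))) - (1/2) ^ n * of_int (int_decode (s n))\<bar>
       \<le> 4 * (1/2) ^ n"
      using assms[of n] assms[of "Suc n"] by linarith
    then show ?case using Suc by (simp add: Let_def)
  qed simp
  have "(\<lambda>n. 2 * (1/2::real) ^ n) \<longlonglongrightarrow> 2 * 0"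
    by (intro tendsto_mult_left LIMSEQ_power_zero) simp
  then have g: "(\<lambda>n. 2 * (1/2::real) ^ n) \<longlonglongrightarrow> 0" by simp
  have "norm (partial_decode s n - r) \<le> 2 * (1/2) ^ n" for n
    using assms[of n] unfolding pd real_norm_def by linarith
  then have "(\<lambda>n. partial_decode s n - r) \<longlonglongrightarrow> 0"
    by (intro Lim_null_comparison[OF eventuallyI g])
  then have "partial_decode s \<longlonglongrightarrow> r" by (simp add: LIM_zero_iff)
  then show ?thesis using partial_decode_lim LIMSEQ_unique by blast
qed

lemma continuous_map_decode:
  "continuous_map nat_power euclideanreal (\<lambda>x. decode (\<lambda>n. x (\<psi>, n)))"
proof (rule continuous_map_realI)
  fix x :: "'a \<times> nat \<Rightarrow> nat" and e :: real assume e: "e > 0"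
  have "e / 17 > 0" using e by simp
  then obtain n where n: "(1/2::real) ^ n < e / 17" using real_arch_pow_inv[of "e / 17" "1/2"] by auto
  define U where "U = cyl (Pair \<psi> ` {..n}) x"
  have "openin nat_power U" unfolding U_def by (intro cyl_clopen) simp
  moreover have "x \<in> U" by (simp add: U_def cyl_def)
  moreover have "\<bar>decode (\<lambda>n. y (\<psi>, n)) - decode (\<lambda>n. x (\<psi>, n))\<bar> < e" if "y \<in> U" for y
  proof -
    have "partial_decode (\<lambda>n. y (\<psi>, n)) n = partial_decode (\<lambda>n. x (\<psi>, n)) n"
      using that by (intro partial_decode_cong) (auto simp: U_def cyl_def)
    then show ?thesis
      using decode_approx[of "\<lambda>n. y (\<psi>, n)" n] decode_approx[of "\<lambda>n. x (\<psi>, n)" n] n e by linarith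
  qed
  ultimately show "\<exists>U. openin nat_power U \<and> x \<in> U \<and>
     (\<forall>y\<in>U. \<bar>decode (\<lambda>n. y (\<psi>, n)) - decode (\<lambda>n. x (\<psi>, n))\<bar> < e)" by blast
qed

theorem AE0_space_universal:
  fixes X :: "'a topology"
  assumes "AE0_space X"
  shows "AE0_wrt TYPE('z) X"
  unfolding AE0_wrt_def
proof (intro allI impI, elim conjE)
  fix Z :: "'z topology" and Z0 and f :: "'z \<Rightarrow> 'a"
  assume dim: "covering_dim_le Z 0" and Z0: "Z0 \<subseteq> topspace Z"
    and f: "continuous_map (subtopology Z Z0) X f"
    and ext: "\<forall>\<psi>. continuous_map X euclideanreal \<psi> \<longrightarrow>
           (\<exists>\<phi>. continuous_map Z euclideanreal \<phi> \<and> (\<forall>z\<in>Z0. \<phi> z = \<psi> (f z)))"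
  let ?C = "\<lambda>\<psi>. continuous_map X euclideanreal \<psi>"
  have cr: "completely_regular_space X" and hs: "Hausdorff_space X"
    using assms by (auto simp: AE0_space_def Tychonoff_space_def)
  obtain \<Phi> where \<Phi>: "\<And>\<psi>. ?C \<psi> \<Longrightarrow> continuous_map Z euclideanreal (\<Phi> \<psi>)"
      "\<And>\<psi> z. ?C \<psi> \<Longrightarrow> z \<in> Z0 \<Longrightarrow> \<Phi> \<psi> z = \<psi> (f z)"
    using ext by metis
  define \<Phi>' where "\<Phi>' = (\<lambda>\<psi>. if ?C \<psi> then \<Phi> \<psi> else (\<lambda>_. 0))"
  have \<Phi>': "continuous_map Z euclideanreal (\<Phi>' \<psi>)" for \<psi> using \<Phi>(1) by (simp add: \<Phi>'_def)
  have "\<exists>c :: 'z \<Rightarrow> nat. continuous_map Z (discrete_topology UNIV) c \<and>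
     (\<forall>z\<in>topspace Z. \<bar>\<Phi>' \<psi> z - (1/2)^n * of_int (int_decode (c z))\<bar> < 2 * (1/2)^n)" for \<psi> n
    by (rule approx_locally_constant[OF dim \<Phi>']) simp
  then obtain c :: "('a \<Rightarrow> real) \<Rightarrow> nat \<Rightarrow> 'z \<Rightarrow> nat"
    where c: "\<And>\<psi> n. continuous_map Z (discrete_topology UNIV) (c \<psi> n)"
     "\<And>\<psi> n z. z \<in> topspace Z \<Longrightarrow> \<bar>\<Phi>' \<psi> z - (1/2)^n * of_int (int_decode (c \<psi> n z))\<bar> < 2 * (1/2)^n"
    by metis
  define h where "h = (\<lambda>z (\<psi>, n). c \<psi> n z)"
  have h: "continuous_map Z nat_power h"
    unfolding continuous_map_componentwise_UNIV using c(1) by (auto simp: h_def)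
  have dec: "decode (\<lambda>n. h z (\<psi>, n)) = \<Phi>' \<psi> z" if "z \<in> topspace Z" for z \<psi>
    by (rule decode_eq) (use c(2)[OF that] in \<open>simp add: h_def\<close>)
  have dec0: "decode (\<lambda>n. h z (\<psi>, n)) = \<psi> (f z)" if "z \<in> Z0" "?C \<psi>" for z \<psi>
    using dec[of z \<psi>] \<Phi>(2)[OF that(2,1)] that Z0 by (auto simp: \<Phi>'_def)
  have fX: "f z \<in> topspace X" if "z \<in> Z0" for z
    using f that Z0 by (auto simp: continuous_map_def Pi_iff)
  have sep: "\<exists>\<psi>. ?C \<psi> \<and> \<psi> x = 0 \<and> (\<forall>y\<in>topspace X - U. \<psi> y = 1)" if "openin X U" "x \<in> U" for U x
  proof -
    have "closedin X (topspace X - U)" "x \<in> topspace X - (topspace X - U)"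
      using that openin_subset[OF that(1)] by auto
    then obtain \<psi> where "continuous_map X (top_of_set {0..1::real}) \<psi>" "\<psi> x = 0"
        "\<psi> ` (topspace X - U) \<subseteq> {1}"
      using cr unfolding completely_regular_space_def by meson
    then show ?thesis by (intro exI[of _ \<psi>]) (auto simp: continuous_map_in_subtopology)
  qed
  have inj: "f z = f z'" if zz: "z \<in> Z0" "z' \<in> Z0" "h z = h z'" for z z'
  proof (rule ccontr)
    assume ne: "f z \<noteq> f z'"
    then obtain U where U: "openin X U" "f z \<in> U" "f z' \<notin> U"
      using hs fX[OF zz(1)] fX[OF zz(2)] unfolding Hausdorff_space_def disjnt_def by (metis disjoint_iff)
    then obtain \<psi> where \<psi>: "?C \<psi>" "\<psi> (f z) = 0" "\<psi> (f z') = 1" using sep[OF U(1,2)] fX[OF zz(2)] by blast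
    then show False using dec0[OF zz(1) \<psi>(1)] dec0[OF zz(2) \<psi>(1)] zz(3) by simp
  qed
  define Y0 where "Y0 = h ` Z0"
  define f' where "f' = (\<lambda>w. f (SOME z. z \<in> Z0 \<and> h z = w))"
  have f'h: "f' (h z) = f z" if "z \<in> Z0" for z
  proof -
    have "(SOME z'. z' \<in> Z0 \<and> h z' = h z) \<in> Z0 \<and> h (SOME z'. z' \<in> Z0 \<and> h z' = h z) = h z"
      by (rule someI) (use that in simp)
    then show ?thesis unfolding f'_def using inj that by blast
  qed
  have f'dec: "decode (\<lambda>n. w (\<psi>, n)) = \<psi> (f' w)" if "w \<in> Y0" "?C \<psi>" for w \<psi>
    using that dec0 f'h by (auto simp: Y0_def)
  have f'X: "f' w \<in> topspace X" if "w \<in> Y0" for w using that f'h fX by (auto simp: Y0_def)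
  have f'cont: "continuous_map (subtopology nat_power Y0) X f'"
    unfolding continuous_map_def
  proof (intro conjI allI impI)
    show "f' \<in> topspace (subtopology nat_power Y0) \<rightarrow> topspace X" using f'X by simp
    fix U assume U: "openin X U"
    show "openin (subtopology nat_power Y0) {w \<in> topspace (subtopology nat_power Y0). f' w \<in> U}"
    proof (subst openin_subopen, intro ballI)
      fix w assume "w \<in> {w \<in> topspace (subtopology nat_power Y0). f' w \<in> U}"
      then have w: "w \<in> Y0" "f' w \<in> U" by auto
      obtain \<psi> where \<psi>: "?C \<psi>" "\<psi> (f' w) = 0" "\<forall>y\<in>topspace X - U. \<psi> y = 1"
        using sep[OF U w(2)] by blast
      define V where "V = {v \<in> topspace nat_power. decode (\<lambda>n. v (\<psi>, n)) \<in> {..<1}}"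
      have "openin nat_power V" unfolding V_def
        by (rule openin_continuous_map_preimage[OF continuous_map_decode]) (simp)
      then have "openin (subtopology nat_power Y0) (Y0 \<inter> V)" by (rule openin_subtopology_Int2)
      moreover have "w \<in> Y0 \<inter> V" using w f'dec[OF w(1) \<psi>(1)] \<psi>(2) by (simp add: V_def)
      moreover have "Y0 \<inter> V \<subseteq> {w \<in> topspace (subtopology nat_power Y0). f' w \<in> U}"
      proof
        fix v assume v: "v \<in> Y0 \<inter> V"
        then have "\<psi> (f' v) < 1" using f'dec[OF _ \<psi>(1), of v] by (simp add: V_def)
        then have "f' v \<in> U" using \<psi>(3) f'X v by force
        then show "v \<in> {w \<in> topspace (subtopology nat_power Y0). f' w \<in> U}" using v by simp
      qed
      ultimately show "\<exists>T. openin (subtopology nat_power Y0) T \<and> w \<in> T \<and>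
         T \<subseteq> {w \<in> topspace (subtopology nat_power Y0). f' w \<in> U}" by blast
    qed
  qed
  have "\<exists>\<phi>. continuous_map nat_power euclideanreal \<phi> \<and> (\<forall>w\<in>Y0. \<phi> w = \<psi> (f' w))" if "?C \<psi>" for \<psi>
    using continuous_map_decode[of \<psi>] f'dec[OF _ that] by blast
  moreover have "AE0_wrt TYPE(('a \<Rightarrow> real) \<times> nat \<Rightarrow> nat) X" using assms by (simp add: AE0_space_def)
  ultimately obtain g where g: "continuous_map nat_power X g" "\<forall>w\<in>Y0. g w = f' w"
    unfolding AE0_wrt_def using Tychonoff_nat_power covering_dim_nat_power f'cont
    by (elim allE[of _ nat_power] allE[of _ Y0] allE[of _ f'] impE) auto
  show "\<exists>g. continuous_map Z X g \<and> (\<forall>z\<in>Z0. g z = f z)"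
  proof (intro exI[of _ "g \<circ> h"] conjI ballI)
    show "continuous_map Z X (g \<circ> h)" using h g(1) by (rule continuous_map_compose)
    fix z assume "z \<in> Z0"
    then show "(g \<circ> h) z = f z" using g(2) f'h by (auto simp: Y0_def)
  qed
qed

end

theory Submission
  imports Defs
begin

text \<open>In a closed subgroup of \<open>S\<^sub>\<infinity>\<^sup>\<tau>\<close>, the pointwise stabilizers of finitely many coordinates are open
  subgroups and form a neighborhood basis at the identity.

  Conversely, let the open subgroups of \<open>G\<close> form a neighborhood basis at the identity. If an open
  subgroup \<open>K\<close> has countable index, then \<open>G\<close> acts on \<open>G/K\<close> by permutations of a countable set, and \<open>K\<close> is
  the stabilizer of a point. One action for each member of a base of cardinality \<open>\<tau>\<close> gives a
  topological embedding of \<open>G\<close> into \<open>S\<^sub>\<infinity>\<^sup>\<tau>\<close>. What has to come from the AE(0)-property is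
  that open subgroups have countable index, and that the image is closed, which means that \<open>G\<close> is
  complete: every filter that is eventually constant modulo each open subgroup, on both sides,
  converges.

  The AE(0)-property enters through a coding. Describe a point \<open>x\<close> by a sequence of dyadic
  approximations to \<open>\<psi> x\<close> for every continuous \<open>\<psi>\<close>. On the set of all \<open>w \<in> \<nat>\<^sup>\<kappa>\<close>
  that describe a point, the map from descriptions to points satisfies the hypothesis of the extension
  property, so it extends to a continuous \<open>g : \<nat>\<^sup>\<kappa> \<rightarrow> G\<close> (\<open>AE0_space_coding\<close>). As it takes only
  finitely many coordinates to determine \<open>g w\<close> approximately, and every point has a
  description extending any partial one that is correct so far, \<open>g\<close> transfers statements about \<open>\<nat>\<^sup>\<kappa>\<close>
  to \<open>G\<close>. In particular, continuous real functions on \<open>\<nat>\<^sup>\<kappa>\<close> depend on countably many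
  coordinates, and this is applied to \<open>(w, v) \<mapsto> \<theta> (g w \<otimes> g v)\<close> (\<open>product_box\<close>). With \<open>\<theta>\<close> the indicator
  function of \<open>K\<close>, countability of the index follows (\<open>countable_cosets\<close>).

  For completeness it suffices that a Cauchy filter selects, for each coordinate \<open>k\<close>, a
  value \<open>w k\<close> that eventually describes its points; the limit is then \<open>g w\<close> (\<open>cauchy_converges\<close>). Such a
  value is found by the argument that shows that a Polish group is complete: if \<open>p\<close> is a point of the
  completion, a Baire category argument writes \<open>p = y z\<close> with \<open>y\<close> and \<open>z\<close> in the group. Here only a
  countable set of coordinates can be controlled at a time, so one obtains codes \<open>s\<close> and \<open>t\<close> such that
  the filter is eventually in the product of the images of any two boxes given by finitely many of the
  countably many coordinates of \<open>s\<close> and \<open>t\<close> (\<open>cauchy_factors\<close>). By the countable dependence this is enough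
  to read off the value at \<open>k\<close> of a description of \<open>g s \<otimes> g t\<close>, and the points of the
  filter eventually share it (\<open>cauchy_selects\<close>).\<close>

section \<open>Coding the points of an AE(0)-space\<close>

text \<open>The number \<open>w k\<close> is a correct value at the coordinate \<open>k\<close> of a description of \<open>x\<close> if \<open>\<phi> k (w k) x > 0\<close>. A
  point may have many descriptions, but \<open>g\<close> recovers it from each of them. Correctness
  is the positivity of a continuous function, not just an open condition, since it is continuous functions
  that depend on countably many coordinates when composed with \<open>g\<close>.\<close>

definition coding :: "'a topology \<Rightarrow> ('k \<Rightarrow> nat \<Rightarrow> 'a \<Rightarrow> real) \<Rightarrow> (('k \<Rightarrow> nat) \<Rightarrow> 'a) \<Rightarrow> bool" where
  "coding X \<phi> g \<longleftrightarrow>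
     (\<forall>k m. continuous_map X euclideanreal (\<phi> k m)) \<and>
     continuous_map nat_power X g \<and>
     (\<forall>k. \<forall>x\<in>topspace X. \<exists>m. \<phi> k m x > 0) \<and>
     (\<forall>w. \<forall>x\<in>topspace X. (\<forall>k. \<phi> k (w k) x > 0) \<longrightarrow> g w = x)"

lemma Tychonoff_space_separate:
  assumes "Tychonoff_space X" "openin X U" "x \<in> U"
  shows "\<exists>\<psi>. continuous_map X euclideanreal \<psi> \<and> \<psi> x = 0 \<and> (\<forall>y\<in>topspace X - U. \<psi> y = 1)"
proof -
  have "closedin X (topspace X - U)" "x \<in> topspace X - (topspace X - U)"
    using assms openin_subset[OF assms(2)] by auto
  then obtain \<psi> where "continuous_map X (top_of_set {0..1::real}) \<psi>" "\<psi> x = 0"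
      "\<psi> ` (topspace X - U) \<subseteq> {1}"
    using assms(1) unfolding Tychonoff_space_def completely_regular_space_def by meson
  then show ?thesis by (intro exI[of _ \<psi>]) (auto simp: continuous_map_in_subtopology)
qed

text \<open>The coordinates are pairs of a continuous function \<open>\<psi>\<close> and a precision \<open>2\<^sup>-\<^sup>n\<close>, and a value is correct
  if it encodes an approximation to \<open>\<psi> x\<close>. The map from descriptions to points meets the hypothesis of
  the extension property because composing it with \<open>\<psi>\<close> gives \<open>decode\<close> at the coordinates of \<open>\<psi>\<close>, which
  is continuous on the whole power.\<close>

lemma AE0_space_coding:
  fixes X :: "'a topology"
  assumes "AE0_space X"
  shows "\<exists>(\<phi> :: ('a \<Rightarrow> real) \<times> nat \<Rightarrow> nat \<Rightarrow> 'a \<Rightarrow> real) g. coding X \<phi> g"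
proof -
  let ?C = "\<lambda>\<psi>. continuous_map X euclideanreal \<psi>"
  have tych: "Tychonoff_space X" and AE: "AE0_wrt TYPE(('a \<Rightarrow> real) \<times> nat \<Rightarrow> nat) X"
    using assms by (auto simp: AE0_space_def)
  define c where "c = (\<lambda>\<psi>. if ?C \<psi> then \<psi> else (\<lambda>_. 0))"
  have c: "?C (c \<psi>)" for \<psi> by (simp add: c_def)
  define \<phi> :: "('a \<Rightarrow> real) \<times> nat \<Rightarrow> nat \<Rightarrow> 'a \<Rightarrow> real" where
    "\<phi> = (\<lambda>(\<psi>, n) m x. 2 * (1/2)^n - \<bar>c \<psi> x - (1/2)^n * of_int (int_decode m)\<bar>)"
  define codes where "codes = (\<lambda>w x. \<forall>k. \<phi> k (w k) x > 0)"
  define Z0 where "Z0 = {w. \<exists>x\<in>topspace X. codes w x}"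
  have dec: "decode (\<lambda>n. w (\<psi>, n)) = c \<psi> x" if "codes w x" for w x \<psi>
  proof (rule decode_eq)
    fix n
    have "\<phi> (\<psi>, n) (w (\<psi>, n)) x > 0" using that unfolding codes_def by blast
    then show "\<bar>c \<psi> x - (1/2) ^ n * of_int (int_decode (w (\<psi>, n)))\<bar> < 2 * (1/2) ^ n"
      by (simp add: \<phi>_def)
  qed
  have inj: "x = y" if wxy: "codes w x" "codes w y" "x \<in> topspace X" "y \<in> topspace X" for w x y
  proof (rule ccontr)
    assume "x \<noteq> y"
    then obtain U where U: "openin X U" "x \<in> U" "y \<notin> U"
      using tych wxy(3,4) unfolding Tychonoff_space_def Hausdorff_space_def disjnt_iff by metis
    obtain \<psi> where \<psi>: "?C \<psi>" "\<psi> x = 0" "\<psi> y = 1"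
      using Tychonoff_space_separate[OF tych U(1,2)] wxy(4) U(3) by blast
    show False using dec[OF wxy(1), of \<psi>] dec[OF wxy(2), of \<psi>] \<psi> by (simp add: c_def)
  qed
  define f where "f = (\<lambda>w. SOME x. x \<in> topspace X \<and> codes w x)"
  have f: "f w \<in> topspace X" "codes w (f w)" if "w \<in> Z0" for w
    using that someI_ex[of "\<lambda>x. x \<in> topspace X \<and> codes w x"] unfolding f_def Z0_def by blast+
  have fdec: "decode (\<lambda>n. w (\<psi>, n)) = \<psi> (f w)" if "w \<in> Z0" "?C \<psi>" for w \<psi>
    using dec[OF f(2)[OF that(1)], of \<psi>] that(2) by (simp add: c_def)
  have fcont: "continuous_map (subtopology nat_power Z0) X f"
    unfolding continuous_map_def
  proof (intro conjI allI impI)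
    show "f \<in> topspace (subtopology nat_power Z0) \<rightarrow> topspace X" using f(1) by simp
    fix U assume U: "openin X U"
    show "openin (subtopology nat_power Z0) {w \<in> topspace (subtopology nat_power Z0). f w \<in> U}"
    proof (subst openin_subopen, intro ballI)
      fix w assume "w \<in> {w \<in> topspace (subtopology nat_power Z0). f w \<in> U}"
      then have w: "w \<in> Z0" "f w \<in> U" by auto
      obtain \<psi> where \<psi>: "?C \<psi>" "\<psi> (f w) = 0" "\<forall>y\<in>topspace X - U. \<psi> y = 1"
        using Tychonoff_space_separate[OF tych U w(2)] by blast
      define V where "V = {v \<in> topspace nat_power. decode (\<lambda>n. v (\<psi>, n)) \<in> {..<1}}"
      have "openin nat_power V" unfolding V_def
        by (rule openin_continuous_map_preimage[OF continuous_map_decode]) simp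
      then have "openin (subtopology nat_power Z0) (Z0 \<inter> V)" by (rule openin_subtopology_Int2)
      moreover have "w \<in> Z0 \<inter> V" using w fdec[OF w(1) \<psi>(1)] \<psi>(2) by (simp add: V_def)
      moreover have "Z0 \<inter> V \<subseteq> {w \<in> topspace (subtopology nat_power Z0). f w \<in> U}"
      proof
        fix v assume v: "v \<in> Z0 \<inter> V"
        then have "\<psi> (f v) < 1" using fdec[OF _ \<psi>(1), of v] by (simp add: V_def)
        then have "f v \<in> U" using \<psi>(3) f(1) v by force
        then show "v \<in> {w \<in> topspace (subtopology nat_power Z0). f w \<in> U}" using v by simp
      qed
      ultimately show "\<exists>T. openin (subtopology nat_power Z0) T \<and> w \<in> T \<and>
         T \<subseteq> {w \<in> topspace (subtopology nat_power Z0). f w \<in> U}" by blast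
    qed
  qed
  have "\<exists>\<eta>. continuous_map nat_power euclideanreal \<eta> \<and> (\<forall>w\<in>Z0. \<eta> w = \<psi> (f w))" if "?C \<psi>" for \<psi>
    using continuous_map_decode[of \<psi>] fdec[OF _ that] by blast
  then obtain g where g: "continuous_map nat_power X g" "\<forall>w\<in>Z0. g w = f w"
    using AE fcont Tychonoff_nat_power covering_dim_nat_power unfolding AE0_wrt_def
    by (elim allE[of _ nat_power] allE[of _ Z0] allE[of _ f] impE) auto
  have "coding X \<phi> g"
    unfolding coding_def
  proof (intro conjI allI ballI impI)
    fix k m
    show "continuous_map X euclideanreal (\<phi> k m)"
      using c unfolding \<phi>_def split_beta by (intro continuous_intros) auto
  next
    fix k :: "('a \<Rightarrow> real) \<times> nat" and x assume "x \<in> topspace X"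
    obtain \<psi> n where k: "k = (\<psi>, n)" by (cases k)
    define j where "j = \<lfloor>2^n * c \<psi> x\<rfloor>"
    have "of_int j \<le> 2^n * c \<psi> x" "2^n * c \<psi> x < of_int j + 1" unfolding j_def by linarith+
    then have "(1/2)^n * of_int j \<le> c \<psi> x" "c \<psi> x < (1/2)^n * of_int j + (1/2)^n"
      by (simp_all add: field_simps)
    then have "\<phi> k (int_encode j) x > 0" by (simp add: \<phi>_def k)
    then show "\<exists>m. \<phi> k m x > 0" by blast
  next
    fix w x assume x: "x \<in> topspace X" "\<forall>k. \<phi> k (w k) x > 0"
    then have "w \<in> Z0" "codes w x" unfolding Z0_def codes_def by auto
    then show "g w = x" using g(2) f inj x(1) by metis
  qed (rule g(1))
  then show ?thesis by blast
qed

text \<open>Any partial description of \<open>x\<close> can be completed. For finite \<open>F\<close>, the image of the box therefore contains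
  an open set, namely the set of all points that the box describes correctly, although \<open>g\<close> need
  not be an open map.\<close>

lemma coding_box:
  assumes "coding X \<phi> g" "x \<in> topspace X" "\<And>k. k \<in> F \<Longrightarrow> \<phi> k (s k) x > 0"
  shows "x \<in> g ` cyl F s"
proof -
  have "\<forall>k. \<exists>m. \<phi> k m x > 0" using assms(1,2) unfolding coding_def by blast
  then obtain v where v: "\<And>k. \<phi> k (v k) x > 0" by metis
  define w where "w = (\<lambda>k. if k \<in> F then s k else v k)"
  have "\<forall>k. \<phi> k (w k) x > 0" using v assms(3) by (simp add: w_def)
  then have "g w = x" using assms(1,2) unfolding coding_def by blast
  moreover have "w \<in> cyl F s" by (simp add: w_def cyl_def)
  ultimately show ?thesis by blast
qed

lemma countable_cylinders:
  assumes "countable A"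
  shows "countable {cyl F s | F s. finite F \<and> F \<subseteq> A}"
proof (rule countable_subset)
  show "{cyl F s | F s. finite F \<and> F \<subseteq> A} \<subseteq>
     (\<Union>F\<in>{F. finite F \<and> F \<subseteq> A}. cyl F ` (Pi\<^sub>E F (\<lambda>_. UNIV)))"
  proof clarify
    fix F and s :: "'a \<Rightarrow> nat" assume F: "finite F" "F \<subseteq> A"
    have "cyl F s = cyl F (restrict s F)" by (simp add: cyl_def)
    moreover have "restrict s F \<in> Pi\<^sub>E F (\<lambda>_. UNIV)" by simp
    ultimately show "cyl F s \<in> (\<Union>F\<in>{F. finite F \<and> F \<subseteq> A}. cyl F ` (Pi\<^sub>E F (\<lambda>_. UNIV)))"
      using F by blast
  qed
  show "countable (\<Union>F\<in>{F. finite F \<and> F \<subseteq> A}. cyl F ` (Pi\<^sub>E F (\<lambda>_. UNIV :: nat set)))"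
    using countable_Collect_finite_subset[OF assms]
    by (intro countable_UN countable_image countable_PiE) auto
qed

text \<open>Truncating \<open>\<Phi>\<close> at \<open>0\<close> makes the set where it is positive functionally open.\<close>

lemma pos_countable_support:
  assumes "continuous_map nat_power euclideanreal \<Phi>"
  obtains D where "countable D" "\<And>w w'. (\<forall>i\<in>D. w i = w' i) \<Longrightarrow> \<Phi> w > 0 \<Longrightarrow> \<Phi> w' > 0"
proof -
  have "continuous_map nat_power euclideanreal (\<lambda>w. max (\<Phi> w) 0)"
    using assms by (intro continuous_intros) auto
  then have "functionally_open nat_power {w. \<Phi> w > 0}"
    unfolding functionally_open_def by (intro exI[of _ "\<lambda>w. max (\<Phi> w) 0"]) auto
  then obtain D where "countable D" "supported D {w. \<Phi> w > 0}"
    using supported_functionally_open by blast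
  then show ?thesis using that unfolding supported_def by blast
qed

section \<open>Cauchy filters on nonarchimedean groups\<close>

locale nonarchimedean_group = group G for G (structure) +
  fixes T :: "'a topology"
  assumes top: "topological_group G T"
    and basis: "open_subgroup_basis_at_one G T"
begin

definition open_subgroup :: "'a set \<Rightarrow> bool" where
  "open_subgroup K \<longleftrightarrow> subgroup K G \<and> openin T K"

lemma topspace_eq: "topspace T = carrier G"
  using top by (simp add: topological_group_def)

lemma cancel_left:
  assumes "x \<in> carrier G" "y \<in> carrier G"
  shows "x \<otimes> (inv x \<otimes> y) = y" "inv x \<otimes> (x \<otimes> y) = y"
  using assms by (simp_all add: m_assoc[symmetric])

lemma continuous_map_mult:
  assumes "continuous_map X T f" "continuous_map X T f'"
  shows "continuous_map X T (\<lambda>x. f x \<otimes> f' x)"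
proof -
  have "continuous_map X (prod_topology T T) (\<lambda>x. (f x, f' x))"
    using assms by (simp add: continuous_map_pairedI)
  moreover have "continuous_map (prod_topology T T) T (\<lambda>(x, y). x \<otimes> y)"
    using top by (simp add: topological_group_def)
  ultimately show ?thesis using continuous_map_compose by (fastforce simp: o_def)
qed

lemma open_subgroup_Int: "open_subgroup H \<Longrightarrow> open_subgroup K \<Longrightarrow> open_subgroup (H \<inter> K)"
  unfolding open_subgroup_def using subgroups_Inter_pair by blast

lemma open_subgroup_carrier: "open_subgroup (carrier G)"
  unfolding open_subgroup_def using subgroup_self topspace_eq openin_topspace by metis

lemma ex_open_subgroup_translate:
  assumes "openin T U" "x \<in> U"
  obtains K where "open_subgroup K" "\<And>k. k \<in> K \<Longrightarrow> x \<otimes> k \<in> U" "\<And>k. k \<in> K \<Longrightarrow> k \<otimes> x \<in> U"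
proof -
  have x: "x \<in> carrier G" using assms openin_subset topspace_eq by blast
  have "continuous_map T T (\<lambda>k. x \<otimes> k)" "continuous_map T T (\<lambda>k. k \<otimes> x)"
    using x topspace_eq by (auto intro!: continuous_map_mult)
  then have "openin T ({k \<in> topspace T. x \<otimes> k \<in> U} \<inter> {k \<in> topspace T. k \<otimes> x \<in> U})"
    using assms(1) by (intro openin_Int openin_continuous_map_preimage)
  moreover have "\<one> \<in> {k \<in> topspace T. x \<otimes> k \<in> U} \<inter> {k \<in> topspace T. k \<otimes> x \<in> U}"
    using x assms(2) topspace_eq by simp
  ultimately obtain K where "open_subgroup K"
      "K \<subseteq> {k \<in> topspace T. x \<otimes> k \<in> U} \<inter> {k \<in> topspace T. k \<otimes> x \<in> U}"
    using basis unfolding open_subgroup_basis_at_one_def open_subgroup_def by blast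
  then show ?thesis using that by blast
qed

lemma open_subgroup_conj:
  assumes "open_subgroup K" "x \<in> carrier G"
  shows "open_subgroup {q \<in> carrier G. inv x \<otimes> q \<otimes> x \<in> K}"
  unfolding open_subgroup_def
proof
  have K: "subgroup K G" "openin T K" using assms(1) by (auto simp: open_subgroup_def)
  have "continuous_map T T (\<lambda>q. inv x \<otimes> q \<otimes> x)"
    using assms(2) topspace_eq by (intro continuous_map_mult) auto
  from openin_continuous_map_preimage[OF this K(2)]
  show "openin T {q \<in> carrier G. inv x \<otimes> q \<otimes> x \<in> K}" by (simp add: topspace_eq)
  show "subgroup {q \<in> carrier G. inv x \<otimes> q \<otimes> x \<in> K} G"
  proof (rule subgroupI)
    show "{q \<in> carrier G. inv x \<otimes> q \<otimes> x \<in> K} \<noteq> {}"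
      using subgroup.one_closed[OF K(1)] assms(2) by (auto intro!: exI[of _ \<one>])
    fix a assume "a \<in> {q \<in> carrier G. inv x \<otimes> q \<otimes> x \<in> K}"
    then have a: "a \<in> carrier G" "inv x \<otimes> a \<otimes> x \<in> K" by auto
    have "inv (inv x \<otimes> a \<otimes> x) = inv x \<otimes> inv a \<otimes> x"
      using a(1) assms(2) by (simp add: inv_mult_group m_assoc)
    then show "inv a \<in> {q \<in> carrier G. inv x \<otimes> q \<otimes> x \<in> K}"
      using a subgroup.m_inv_closed[OF K(1) a(2)] by simp
    fix b assume "b \<in> {q \<in> carrier G. inv x \<otimes> q \<otimes> x \<in> K}"
    then have b: "b \<in> carrier G" "inv x \<otimes> b \<otimes> x \<in> K" by auto
    have "(inv x \<otimes> a \<otimes> x) \<otimes> (inv x \<otimes> b \<otimes> x) = inv x \<otimes> (a \<otimes> b) \<otimes> x"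
      using a(1) b(1) assms(2) by (simp add: m_assoc cancel_left)
    then show "a \<otimes> b \<in> {q \<in> carrier G. inv x \<otimes> q \<otimes> x \<in> K}"
      using a b subgroup.m_closed[OF K(1) a(2) b(2)] by simp
  qed auto
qed

text \<open>These are the traces on \<open>G\<close> of neighborhood filters of points of the two-sided (Raikov) completion:
  modulo each open subgroup, both the left and the right coset of the points are eventually
  constant.\<close>

definition cauchy :: "'a filter \<Rightarrow> bool" where
  "cauchy \<F> \<longleftrightarrow> \<F> \<noteq> bot \<and> (\<forall>\<^sub>F q in \<F>. q \<in> carrier G) \<and>
     (\<forall>K. open_subgroup K \<longrightarrow> (\<exists>a\<in>carrier G. \<forall>\<^sub>F q in \<F>. inv a \<otimes> q \<in> K) \<and>
                       (\<exists>b\<in>carrier G. \<forall>\<^sub>F q in \<F>. q \<otimes> inv b \<in> K))"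

text \<open>If \<open>p\<close> denotes the point of the completion that the filter converges to, then the hypothesis says that
  \<open>p\<close> is in the closure of \<open>x K y\<close>. Keeping one factor fixed, the other one can be changed
  within \<open>K\<close> so that \<open>K\<close> is replaced by a smaller open subgroup. The new factor is a
  representative of the eventual coset of \<open>p\<close> modulo a conjugate of \<open>K'\<close>: a left coset if \<open>x\<close> is to be
  changed, a right coset if \<open>y\<close> is.\<close>

lemma cauchy_refine_left:
  assumes "cauchy \<F>" "open_subgroup K" "open_subgroup K'" "K' \<subseteq> K" "x \<in> carrier G" "y \<in> carrier G"
    and E: "\<forall>\<^sub>F q in \<F>. inv x \<otimes> q \<otimes> inv y \<in> K"
  obtains k where "k \<in> K" "\<forall>\<^sub>F q in \<F>. inv (x \<otimes> k) \<otimes> q \<otimes> inv y \<in> K'"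
proof -
  have K: "subgroup K G" using assms(2) by (simp add: open_subgroup_def)
  obtain a where a: "a \<in> carrier G"
      "\<forall>\<^sub>F q in \<F>. inv a \<otimes> q \<in> {q \<in> carrier G. inv (inv y) \<otimes> q \<otimes> inv y \<in> K'}"
    using assms(1) open_subgroup_conj[OF assms(3), of "inv y"] assms(6) unfolding cauchy_def by auto
  define k where "k = inv x \<otimes> a \<otimes> inv y"
  have kG: "k \<in> carrier G" using a assms by (simp add: k_def)
  have inv: "inv (x \<otimes> k) = y \<otimes> inv a"
    using a assms(5,6) by (simp add: k_def m_assoc inv_mult_group cancel_left)
  have F: "\<forall>\<^sub>F q in \<F>. q \<in> carrier G" using assms(1) by (simp add: cauchy_def)
  have ev: "\<forall>\<^sub>F q in \<F>. inv (x \<otimes> k) \<otimes> q \<otimes> inv y \<in> K'"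
    using a(2) F
  proof eventually_elim
    case (elim q)
    then show ?case using a(1) assms(6) by (simp add: inv m_assoc)
  qed
  have "\<exists>q. inv (x \<otimes> k) \<otimes> q \<otimes> inv y \<in> K' \<and> q \<in> carrier G \<and> inv x \<otimes> q \<otimes> inv y \<in> K"
    using eventually_happens'[OF _ eventually_conj[OF ev eventually_conj[OF F E]]] assms(1)
    by (auto simp: cauchy_def)
  then obtain q where q: "inv (x \<otimes> k) \<otimes> q \<otimes> inv y \<in> K" "q \<in> carrier G" "inv x \<otimes> q \<otimes> inv y \<in> K"
    using assms(4) by blast
  have "k = (inv x \<otimes> q \<otimes> inv y) \<otimes> inv (inv (x \<otimes> k) \<otimes> q \<otimes> inv y)"
    using q(2) assms(5,6) kG by (simp add: m_assoc inv_mult_group cancel_left)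
  then have "k \<in> K"
    using subgroup.m_closed[OF K q(3) subgroup.m_inv_closed[OF K q(1)]] by simp
  then show ?thesis using that ev by blast
qed

lemma cauchy_refine_right:
  assumes "cauchy \<F>" "open_subgroup K" "open_subgroup K'" "K' \<subseteq> K" "x \<in> carrier G" "y \<in> carrier G"
    and E: "\<forall>\<^sub>F q in \<F>. inv x \<otimes> q \<otimes> inv y \<in> K"
  obtains k where "k \<in> K" "\<forall>\<^sub>F q in \<F>. inv x \<otimes> q \<otimes> inv (k \<otimes> y) \<in> K'"
proof -
  have K: "subgroup K G" using assms(2) by (simp add: open_subgroup_def)
  obtain b where b: "b \<in> carrier G"
      "\<forall>\<^sub>F q in \<F>. q \<otimes> inv b \<in> {q \<in> carrier G. inv x \<otimes> q \<otimes> x \<in> K'}"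
    using assms(1) open_subgroup_conj[OF assms(3,5)] unfolding cauchy_def by auto
  define k where "k = inv x \<otimes> b \<otimes> inv y"
  have kG: "k \<in> carrier G" using b assms by (simp add: k_def)
  have inv: "inv (k \<otimes> y) = inv b \<otimes> x"
    using b assms(5,6) by (simp add: k_def m_assoc inv_mult_group)
  have F: "\<forall>\<^sub>F q in \<F>. q \<in> carrier G" using assms(1) by (simp add: cauchy_def)
  have ev: "\<forall>\<^sub>F q in \<F>. inv x \<otimes> q \<otimes> inv (k \<otimes> y) \<in> K'"
    using b(2) F
  proof eventually_elim
    case (elim q)
    then show ?case using b(1) assms(5) by (simp add: inv m_assoc)
  qed
  have "\<exists>q. inv x \<otimes> q \<otimes> inv (k \<otimes> y) \<in> K' \<and> q \<in> carrier G \<and> inv x \<otimes> q \<otimes> inv y \<in> K"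
    using eventually_happens'[OF _ eventually_conj[OF ev eventually_conj[OF F E]]] assms(1)
    by (auto simp: cauchy_def)
  then obtain q where q: "inv x \<otimes> q \<otimes> inv (k \<otimes> y) \<in> K" "q \<in> carrier G" "inv x \<otimes> q \<otimes> inv y \<in> K"
    using assms(4) by blast
  have "k = inv (inv x \<otimes> q \<otimes> inv (k \<otimes> y)) \<otimes> (inv x \<otimes> q \<otimes> inv y)"
    using q(2) assms(5,6) kG by (simp add: m_assoc inv_mult_group cancel_left)
  then have "k \<in> K"
    using subgroup.m_closed[OF K subgroup.m_inv_closed[OF K q(1)] q(3)] by simp
  then show ?thesis using that ev by blast
qed

end

section \<open>Countable index and completeness\<close>

locale coded_nonarchimedean_group = nonarchimedean_group G T for G (structure) and T :: "'a topology" +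
  fixes \<phi> :: "'k \<Rightarrow> nat \<Rightarrow> 'a \<Rightarrow> real" and g :: "('k \<Rightarrow> nat) \<Rightarrow> 'a"
  assumes coding: "coding T \<phi> g"
begin

lemma g_closed: "g w \<in> carrier G"
  using coding topspace_eq unfolding coding_def continuous_map_def by auto

lemma open_pos: "openin T {x \<in> carrier G. \<phi> k m x > 0}"
proof -
  have "openin T {x \<in> topspace T. \<phi> k m x \<in> {0<..}}"
    using coding unfolding coding_def by (intro openin_continuous_map_preimage) auto
  then show ?thesis by (simp add: topspace_eq)
qed

text \<open>As a box in \<open>\<nat>\<^sup>\<kappa>\<close> is given by finitely many coordinates, continuity of \<open>(w, v) \<mapsto> \<theta> (g w \<otimes> g v)\<close> provides the
  box. The point is that its coordinates can be taken from a countable set that depends on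
  \<open>\<theta>\<close> only. Two copies of \<open>\<kappa>\<close> turn a pair of codes into a single point of a power of \<open>\<nat>\<close>.\<close>

lemma product_box:
  fixes \<theta> :: "'a \<Rightarrow> real"
  assumes "continuous_map T euclideanreal \<theta>"
  shows "\<exists>A. countable A \<and> (\<forall>s t. \<theta> (g s \<otimes> g t) > 0 \<longrightarrow>
     (\<exists>F. finite F \<and> F \<subseteq> A \<and> (\<forall>x\<in>g ` cyl F s. \<forall>y\<in>g ` cyl F t. \<theta> (x \<otimes> y) > 0)))"
proof -
  define \<Theta> :: "('k + 'k \<Rightarrow> nat) \<Rightarrow> real" where
    "\<Theta> = (\<lambda>w. \<theta> (g (\<lambda>k. w (Inl k)) \<otimes> g (\<lambda>k. w (Inr k))))"
  have g: "continuous_map nat_power T g" using coding by (simp add: coding_def)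
  have "continuous_map nat_power nat_power (\<lambda>w :: 'k + 'k \<Rightarrow> nat. \<lambda>k. w (Inl k))"
       "continuous_map nat_power nat_power (\<lambda>w :: 'k + 'k \<Rightarrow> nat. \<lambda>k. w (Inr k))"
    unfolding continuous_map_componentwise_UNIV by (auto intro: continuous_map_coord)
  then have "continuous_map nat_power T (\<lambda>w :: 'k + 'k \<Rightarrow> nat. g (\<lambda>k. w (Inl k)) \<otimes> g (\<lambda>k. w (Inr k)))"
    using continuous_map_compose[OF _ g] by (intro continuous_map_mult) (auto simp: o_def)
  then have \<Theta>: "continuous_map nat_power euclideanreal \<Theta>"
    unfolding \<Theta>_def using continuous_map_compose[OF _ assms] by (fastforce simp: o_def)
  obtain D where D: "countable D" "\<And>w w'. (\<forall>i\<in>D. w i = w' i) \<Longrightarrow> \<Theta> w > 0 \<Longrightarrow> \<Theta> w' > 0"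
    using pos_countable_support[OF \<Theta>] by blast
  define A where "A = {k. Inl k \<in> D \<or> Inr k \<in> D}"
  have "A = {k \<in> UNIV. Inl k \<in> D} \<union> {k \<in> UNIV. Inr k \<in> D}" by (auto simp: A_def)
  then have "countable A"
    using countable_image_inj_gen[OF inj_Inl[of UNIV] D(1)]
      countable_image_inj_gen[OF inj_Inr[of UNIV] D(1)] by simp
  moreover have "\<exists>F. finite F \<and> F \<subseteq> A \<and> (\<forall>x\<in>g ` cyl F s. \<forall>y\<in>g ` cyl F t. \<theta> (x \<otimes> y) > 0)"
    if pos: "\<theta> (g s \<otimes> g t) > 0" for s t
  proof -
    define w where "w = case_sum s t"
    have "openin nat_power {w \<in> topspace nat_power. \<Theta> w \<in> {0<..}}"
      by (rule openin_continuous_map_preimage[OF \<Theta>]) simp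
    moreover have "w \<in> {w \<in> topspace nat_power. \<Theta> w \<in> {0<..}}"
      using pos by (simp add: w_def \<Theta>_def)
    ultimately obtain C where C: "finite C" "cyl C w \<subseteq> {w \<in> topspace nat_power. \<Theta> w \<in> {0<..}}"
      by (rule open_cyl)
    define F where "F = {k. Inl k \<in> C \<or> Inr k \<in> C} \<inter> A"
    have "{k. Inl k \<in> C \<or> Inr k \<in> C} = Inl -` C \<union> Inr -` C" by auto
    then have "finite F" using C(1) by (simp add: F_def finite_vimageI)
    moreover have "\<theta> (g s' \<otimes> g t') > 0" if "s' \<in> cyl F s" "t' \<in> cyl F t" for s' t'
    proof -
      \<comment> \<open>On \<open>D\<close>, which decides positivity of \<open>\<Theta>\<close>, the point \<open>v\<close> agrees with the pair \<open>(s', t')\<close>;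
        off \<open>D\<close> it is moved back to \<open>w\<close>, so that it lies in the box around \<open>w\<close>.\<close>
      define v where "v = (\<lambda>i. if i \<in> D then case_sum s' t' i else w i)"
      have "v i = w i" if "i \<in> C" for i
        using that \<open>s' \<in> cyl F s\<close> \<open>t' \<in> cyl F t\<close>
        by (cases i) (auto simp: v_def w_def cyl_def F_def A_def)
      then have "v \<in> cyl C w" by (simp add: cyl_def)
      then have "\<Theta> v > 0" using C(2) by auto
      then have "\<Theta> (case_sum s' t') > 0" by (rule D(2)[rotated]) (simp add: v_def)
      then show ?thesis by (simp add: \<Theta>_def)
    qed
    ultimately have "\<exists>F. finite F \<and> F \<subseteq> A \<and> (\<forall>s'\<in>cyl F s. \<forall>t'\<in>cyl F t. \<theta> (g s' \<otimes> g t') > 0)"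
      unfolding F_def by (intro exI[of _ "{k. Inl k \<in> C \<or> Inr k \<in> C} \<inter> A"]) simp
    then show ?thesis by simp
  qed
  ultimately show ?thesis by (intro exI[of _ A]) simp
qed

lemma code_exists:
  assumes "x \<in> carrier G"
  obtains s where "g s = x"
  using coding_box[OF coding, of x "{}"] assms topspace_eq by auto

text \<open>Apply \<open>product_box\<close> to the indicator function of \<open>K\<close>, at codes of \<open>inv x\<close> and \<open>x\<close>. If two points \<open>x\<close> and \<open>y\<close>
  lead to the same pair of boxes, then \<open>inv x \<otimes> y \<in> K\<close>; and there are only countably
  many pairs of boxes with coordinates in a countable set.\<close>

lemma countable_cosets:
  assumes "open_subgroup K"
  obtains c :: "'a \<Rightarrow> nat" where
    "\<And>x y. x \<in> carrier G \<Longrightarrow> y \<in> carrier G \<Longrightarrow> c x = c y \<longleftrightarrow> inv x \<otimes> y \<in> K"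
proof -
  have K: "subgroup K G" "openin T K" using assms by (auto simp: open_subgroup_def)
  define \<theta> :: "'a \<Rightarrow> real" where "\<theta> = (\<lambda>x. if x \<in> K then 1 else 0)"
  have \<theta>: "continuous_map T euclideanreal \<theta>"
  proof (rule continuous_map_realI)
    fix x and e :: real assume x: "x \<in> topspace T" "e > 0"
    have xG: "x \<in> carrier G" using x topspace_eq by simp
    have "continuous_map T T (\<lambda>y. inv x \<otimes> y)"
      using xG topspace_eq by (intro continuous_map_mult) auto
    from openin_continuous_map_preimage[OF this K(2)]
    have "openin T {y \<in> carrier G. inv x \<otimes> y \<in> K}" by (simp add: topspace_eq)
    moreover have "x \<in> {y \<in> carrier G. inv x \<otimes> y \<in> K}"
      using xG subgroup.one_closed[OF K(1)] by simp
    moreover have "y \<in> K \<longleftrightarrow> x \<in> K" if "y \<in> carrier G" "inv x \<otimes> y \<in> K" for y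
    proof
      assume "y \<in> K"
      then have "y \<otimes> inv (inv x \<otimes> y) \<in> K" using that K(1) by (simp add: subgroup.m_closed subgroup.m_inv_closed)
      then show "x \<in> K" using that(1) xG by (simp add: inv_mult_group cancel_left)
    next
      assume "x \<in> K"
      then have "x \<otimes> (inv x \<otimes> y) \<in> K" using that K(1) by (simp add: subgroup.m_closed)
      then show "y \<in> K" using that(1) xG by (simp add: cancel_left)
    qed
    ultimately show "\<exists>U. openin T U \<and> x \<in> U \<and> (\<forall>y\<in>U. \<bar>\<theta> y - \<theta> x\<bar> < e)"
      using x(2) by (intro exI[of _ "{y \<in> carrier G. inv x \<otimes> y \<in> K}"]) (auto simp: \<theta>_def)
  qed
  from product_box[OF \<theta>] obtain A where A: "countable A" "\<And>s t. \<theta> (g s \<otimes> g t) > 0 \<Longrightarrow>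
     \<exists>F. finite F \<and> F \<subseteq> A \<and> (\<forall>x\<in>g ` cyl F s. \<forall>y\<in>g ` cyl F t. \<theta> (x \<otimes> y) > 0)"
    by (elim exE conjE) simp
  define \<C> where "\<C> = {cyl F s | F s. finite F \<and> F \<subseteq> A}"
  have countable: "countable (\<C> \<times> \<C>)"
    unfolding \<C>_def using countable_cylinders[OF A(1)] by simp
  have "\<exists>B\<in>\<C> \<times> \<C>. inv x \<in> g ` fst B \<and> x \<in> g ` snd B \<and>
      (\<forall>a\<in>g ` fst B. \<forall>b\<in>g ` snd B. a \<otimes> b \<in> K)" if x: "x \<in> carrier G" for x
  proof -
    obtain s where s: "g s = inv x" using code_exists[of "inv x"] x by auto
    obtain t where t: "g t = x" using code_exists[OF x] by auto
    have "\<theta> (g s \<otimes> g t) > 0" using s t x subgroup.one_closed[OF K(1)] by (simp add: \<theta>_def)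
    from A(2)[OF this] obtain F where F: "finite F" "F \<subseteq> A"
        "\<forall>x\<in>g ` cyl F s. \<forall>y\<in>g ` cyl F t. \<theta> (x \<otimes> y) > 0"
      by (elim exE conjE)
    have "(cyl F s, cyl F t) \<in> \<C> \<times> \<C>" using F by (auto simp: \<C>_def)
    moreover have "\<forall>a\<in>g ` cyl F s. \<forall>b\<in>g ` cyl F t. a \<otimes> b \<in> K"
      using F(3) by (force simp: \<theta>_def split: if_splits)
    moreover have "inv x \<in> g ` cyl F s" "x \<in> g ` cyl F t"
      using s t by (force simp: cyl_def)+
    ultimately show ?thesis by (intro bexI[of _ "(cyl F s, cyl F t)"]) auto
  qed
  then have "\<forall>x\<in>carrier G. \<exists>B. B \<in> \<C> \<times> \<C> \<and> inv x \<in> g ` fst B \<and> x \<in> g ` snd B \<and>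
      (\<forall>a\<in>g ` fst B. \<forall>b\<in>g ` snd B. a \<otimes> b \<in> K)" by blast
  from bchoice[OF this] obtain B where B: "\<And>x. x \<in> carrier G \<Longrightarrow> B x \<in> \<C> \<times> \<C> \<and>
      inv x \<in> g ` fst (B x) \<and> x \<in> g ` snd (B x) \<and>
      (\<forall>a\<in>g ` fst (B x). \<forall>b\<in>g ` snd (B x). a \<otimes> b \<in> K)" by blast
  define d where "d = (\<lambda>x. to_nat_on (\<C> \<times> \<C>) (B x))"
  have d: "inv x \<otimes> y \<in> K" if "x \<in> carrier G" "y \<in> carrier G" "d x = d y" for x y
  proof -
    have "B x = B y"
      by (rule inj_onD[OF inj_on_to_nat_on[OF countable] that(3)[unfolded d_def]
            conjunct1[OF B[OF that(1)]] conjunct1[OF B[OF that(2)]]])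
    then have "y \<in> g ` snd (B x)" using B[OF that(2)] by simp
    then show ?thesis using B[OF that(1)] by blast
  qed
  have sym: "inv y \<otimes> x \<in> K" if "x \<in> carrier G" "y \<in> carrier G" "inv x \<otimes> y \<in> K" for x y
    using subgroup.m_inv_closed[OF K(1) that(3)] that by (simp add: inv_mult_group)
  have trans: "inv x \<otimes> z \<in> K"
    if "x \<in> carrier G" "y \<in> carrier G" "z \<in> carrier G" "inv x \<otimes> y \<in> K" "inv y \<otimes> z \<in> K" for x y z
    using subgroup.m_closed[OF K(1) that(4,5)] that by (simp add: m_assoc cancel_left)
  \<comment> \<open>Taking the least label in a coset makes labels depend on the coset only.\<close>
  define c where "c = (\<lambda>x. LEAST n. \<exists>y\<in>carrier G. inv x \<otimes> y \<in> K \<and> d y = n)"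
  have c: "\<exists>y\<in>carrier G. inv x \<otimes> y \<in> K \<and> d y = c x" if "x \<in> carrier G" for x
    unfolding c_def by (rule LeastI[of _ "d x"])
      (use that subgroup.one_closed[OF K(1)] in \<open>auto intro!: bexI[of _ x]\<close>)
  show ?thesis
  proof (rule that[of c])
    fix x y assume xy: "x \<in> carrier G" "y \<in> carrier G"
    show "c x = c y \<longleftrightarrow> inv x \<otimes> y \<in> K"
    proof
      assume eq: "c x = c y"
      obtain u where u: "u \<in> carrier G" "inv x \<otimes> u \<in> K" "d u = c x" using c[OF xy(1)] by blast
      obtain v where v: "v \<in> carrier G" "inv y \<otimes> v \<in> K" "d v = c y" using c[OF xy(2)] by blast
      have "inv u \<otimes> v \<in> K" using d u v eq by metis
      then have "inv x \<otimes> v \<in> K" by (rule trans[OF xy(1) u(1) v(1) u(2)])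
      then show "inv x \<otimes> y \<in> K" by (rule trans[OF xy(1) v(1) xy(2) _ sym[OF xy(2) v(1,2)]])
    next
      assume *: "inv x \<otimes> y \<in> K"
      have "inv x \<otimes> z \<in> K \<longleftrightarrow> inv y \<otimes> z \<in> K" if "z \<in> carrier G" for z
        using trans[OF xy that *] trans[OF xy(2,1) that sym[OF xy *]] by blast
      then show "c x = c y" unfolding c_def by (metis (no_types, lifting))
    qed
  qed
qed

text \<open>This is the Baire category argument. Let \<open>p\<close> be the point of the completion that the filter converges
  to. In a game, \<open>x\<close>, \<open>y\<close> and \<open>K\<close> are changed such that \<open>p\<close> stays in the closure of \<open>x K y\<close>. In the round \<open>n\<close>
  the values of \<open>s\<close> and \<open>t\<close> at the coordinate \<open>e n\<close> are read off from the current
  factors, and \<open>K\<close> is made so small that later changes respect them. The open sets \<open>P\<close> and \<open>Q\<close> collect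
  these constraints on the first and the second factor.\<close>

lemma cauchy_factors:
  fixes e :: "nat \<Rightarrow> 'k"
  assumes "cauchy \<F>"
  shows "\<exists>s t. \<forall>n. \<forall>\<^sub>F q in \<F>.
     \<exists>u\<in>g ` cyl (e ` {..<n}) s. \<exists>v\<in>g ` cyl (e ` {..<n}) t. q = u \<otimes> v"
proof -
  define O' where "O' = (\<lambda>k m. {x \<in> carrier G. \<phi> k m x > 0})"
  have cov: "\<exists>m. x \<in> O' k m" if "x \<in> carrier G" for x k
    using coding that topspace_eq unfolding coding_def O'_def by blast
  have openO: "openin T (O' k m)" for k m unfolding O'_def by (rule open_pos)
  define E where "E x K y \<longleftrightarrow> (\<forall>\<^sub>F q in \<F>. inv x \<otimes> q \<otimes> inv y \<in> K)" for x K y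
  \<comment> \<open>Only \<open>y\<close> itself is required to be in \<open>Q\<close>, but all of \<open>x K\<close> in \<open>P\<close>: the next change is one of \<open>x\<close>.\<close>
  define Inv where "Inv = (\<lambda>(n::nat) (x, y, K, P, Q). x \<in> carrier G \<and> y \<in> carrier G \<and> open_subgroup K \<and>
     openin T P \<and> openin T Q \<and> E x K y \<and> (\<forall>k\<in>K. x \<otimes> k \<in> P) \<and> y \<in> Q)"
  define step where "step = (\<lambda>n (x :: 'a, y :: 'a, K :: 'a set, P, Q) (x' :: 'a, y' :: 'a, K' :: 'a set, P', Q').
     (\<exists>m. P' = P \<inter> O' (e n) m) \<and> (\<exists>m. Q' = Q \<inter> O' (e n) m))"
  have "\<exists>\<sigma>. \<forall>n. Inv n (\<sigma> n) \<and> step n (\<sigma> n) (\<sigma> (Suc n))"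
  proof (rule dependent_nat_choice)
    have "\<forall>\<^sub>F q in \<F>. q \<in> carrier G" using assms by (simp add: cauchy_def)
    then have "E \<one> (carrier G) \<one>" unfolding E_def by eventually_elim simp
    then have "Inv 0 (\<one>, \<one>, carrier G, carrier G, carrier G)"
      using open_subgroup_carrier by (simp add: Inv_def open_subgroup_def)
    then show "\<exists>\<sigma>. Inv 0 \<sigma>" ..
  next
    fix \<sigma> n assume inv: "Inv n \<sigma>"
    obtain x y K P Q where \<sigma>: "\<sigma> = (x, y, K, P, Q)" by (rule prod_cases5)
    from inv have x: "x \<in> carrier G" and y: "y \<in> carrier G"
      and K: "open_subgroup K" and P: "openin T P" and Q: "openin T Q" and E: "E x K y"
      and xK: "\<And>k. k \<in> K \<Longrightarrow> x \<otimes> k \<in> P" and yQ: "y \<in> Q"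
      by (simp_all add: Inv_def \<sigma>)
    obtain m where m: "y \<in> O' (e n) m" using cov[OF y] by blast
    \<comment> \<open>First half of the round: fix the value of \<open>t\<close>, protect it by a smaller subgroup, and change \<open>x\<close>.\<close>
    define Q' where "Q' = Q \<inter> O' (e n) m"
    have Q': "openin T Q'" "y \<in> Q'" using Q openO yQ m by (auto simp: Q'_def)
    obtain L where L: "open_subgroup L" "\<And>k. k \<in> L \<Longrightarrow> k \<otimes> y \<in> Q'"
      by (rule ex_open_subgroup_translate[OF Q'], rule that)
    have KL: "open_subgroup (K \<inter> L)" using open_subgroup_Int K L(1) by blast
    obtain k where k: "k \<in> K" "E (x \<otimes> k) (K \<inter> L) y"
      by (rule cauchy_refine_left[OF assms K KL Int_lower1 x y E[unfolded E_def], folded E_def])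
    have kG: "k \<in> carrier G" using k(1) K subgroup.subset unfolding open_subgroup_def by blast
    define x' where "x' = x \<otimes> k"
    have x': "x' \<in> carrier G" "x' \<in> P" using x kG xK[OF k(1)] by (auto simp: x'_def)
    have E': "E x' (K \<inter> L) y" using k(2) by (simp add: x'_def)
    obtain m' where m': "x' \<in> O' (e n) m'" using cov[OF x'(1)] by blast
    \<comment> \<open>Second half: fix the value of \<open>s\<close> for the new \<open>x\<close>, protect it, and change \<open>y\<close>.\<close>
    define P' where "P' = P \<inter> O' (e n) m'"
    have P': "openin T P'" "x' \<in> P'" using P openO x'(2) m' by (auto simp: P'_def)
    obtain M where M: "open_subgroup M" "\<And>k. k \<in> M \<Longrightarrow> x' \<otimes> k \<in> P'"
      by (rule ex_open_subgroup_translate[OF P'], rule that)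
    have KLM: "open_subgroup (K \<inter> L \<inter> M)" using open_subgroup_Int KL M(1) by blast
    obtain j where j: "j \<in> K \<inter> L" "E x' (K \<inter> L \<inter> M) (j \<otimes> y)"
      by (rule cauchy_refine_right[OF assms KL KLM Int_lower1 x'(1) y E'[unfolded E_def], folded E_def])
    have jG: "j \<in> carrier G" using j(1) K subgroup.subset unfolding open_subgroup_def by blast
    have "Inv (Suc n) (x', j \<otimes> y, K \<inter> L \<inter> M, P', Q')"
      using x'(1) y jG KLM P'(1) Q'(1) j L(2) M(2) by (simp add: Inv_def)
    moreover have "step n \<sigma> (x', j \<otimes> y, K \<inter> L \<inter> M, P', Q')"
      unfolding step_def \<sigma> P'_def Q'_def by auto
    ultimately show "\<exists>\<sigma>'. Inv (Suc n) \<sigma>' \<and> step n \<sigma> \<sigma>'" by (intro exI conjI)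
  qed
  then obtain \<sigma> where \<sigma>: "\<forall>n. Inv n (\<sigma> n) \<and> step n (\<sigma> n) (\<sigma> (Suc n))" by (elim exE)
  define x where "x = (\<lambda>n. fst (\<sigma> n))"
  define y where "y = (\<lambda>n. fst (snd (\<sigma> n)))"
  define K where "K = (\<lambda>n. fst (snd (snd (\<sigma> n))))"
  define P where "P = (\<lambda>n. fst (snd (snd (snd (\<sigma> n)))))"
  define Q where "Q = (\<lambda>n. snd (snd (snd (snd (\<sigma> n)))))"
  have \<sigma>eq: "\<sigma> n = (x n, y n, K n, P n, Q n)" for n
    by (simp add: x_def y_def K_def P_def Q_def)
  have I: "x n \<in> carrier G" "y n \<in> carrier G" "open_subgroup (K n)" "openin T (P n)" "E (x n) (K n) (y n)"
     "\<And>k. k \<in> K n \<Longrightarrow> x n \<otimes> k \<in> P n" "y n \<in> Q n" for n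
    using \<sigma>[THEN spec, of n] by (simp_all add: \<sigma>eq Inv_def)
  have "\<forall>n. \<exists>a. P (Suc n) = P n \<inter> O' (e n) a" "\<forall>n. \<exists>b. Q (Suc n) = Q n \<inter> O' (e n) b"
    using \<sigma> by (simp_all add: \<sigma>eq step_def)
  then obtain a b where ab: "\<And>n. P (Suc n) = P n \<inter> O' (e n) (a n)"
      "\<And>n. Q (Suc n) = Q n \<inter> O' (e n) (b n)" by metis
  have PO: "P n \<subseteq> O' (e i) (a i)" "Q n \<subseteq> O' (e i) (b i)" if "i < n" for i n
    using that by (induction n) (auto simp: ab less_Suc_eq)
  \<comment> \<open>The enumeration \<open>e\<close> may repeat an index; its first occurrence decides.\<close>
  define first where "first = (\<lambda>r k. r (LEAST i. e i = k) :: nat)"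
  have box: "u \<in> g ` cyl (e ` {..<n}) (first r)"
    if u: "u \<in> carrier G" "\<And>i. i < n \<Longrightarrow> u \<in> O' (e i) (r i)" for u n r
  proof (rule coding_box[OF coding])
    show "u \<in> topspace T" using u(1) topspace_eq by simp
    fix k assume "k \<in> e ` {..<n}"
    then obtain i where i: "i < n" "e i = k" by auto
    have least: "e (LEAST i. e i = k) = k" using i(2) by (rule LeastI)
    have "(LEAST i. e i = k) < n" using Least_le[of "\<lambda>i. e i = k" i] i by simp
    then show "\<phi> k (first r k) u > 0"
      using u(2)[of "LEAST i. e i = k"] least by (simp add: O'_def first_def)
  qed
  have "\<forall>\<^sub>F q in \<F>. \<exists>u\<in>g ` cyl (e ` {..<n}) (first a). \<exists>v\<in>g ` cyl (e ` {..<n}) (first b). q = u \<otimes> v" for n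
  proof -
    have "\<forall>\<^sub>F q in \<F>. q \<in> carrier G" using assms by (simp add: cauchy_def)
    moreover have "\<forall>\<^sub>F q in \<F>. inv (x n) \<otimes> q \<otimes> inv (y n) \<in> K n" using I(5) by (simp add: E_def)
    ultimately show ?thesis
    proof eventually_elim
      case (elim q)
      define h where "h = inv (x n) \<otimes> q \<otimes> inv (y n)"
      have h: "h \<in> carrier G" "x n \<otimes> h \<in> P n"
        using elim I(1,2)[of n] I(6)[of h n] by (simp_all add: h_def)
      have "q = (x n \<otimes> h) \<otimes> y n" using elim(1) I(1,2) by (simp add: h_def m_assoc cancel_left)
      moreover have "x n \<otimes> h \<in> g ` cyl (e ` {..<n}) (first a)"
        using I(1) h(1) by (intro box[OF _ subsetD[OF PO(1) h(2)]]) simp_all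
      moreover have "y n \<in> g ` cyl (e ` {..<n}) (first b)"
        by (rule box[OF I(2) subsetD[OF PO(2) I(7)]])
      ultimately show ?case by (intro bexI)
    qed
  qed
  then show ?thesis by (intro exI allI)
qed

text \<open>Let \<open>m\<close> be a correct value for \<open>g s \<otimes> g t\<close> at \<open>k\<close>, where \<open>s\<close> and \<open>t\<close> are obtained from \<open>cauchy_factors\<close> for
  an enumeration of countably many coordinates. These are chosen beforehand, and for all possible
  values \<open>m\<close> at once, such that they decide whether \<open>m\<close> is correct for a product.\<close>

lemma cauchy_selects:
  assumes "cauchy \<F>"
  shows "\<exists>m. \<forall>\<^sub>F q in \<F>. \<phi> k m q > 0"
proof -
  have "continuous_map T euclideanreal (\<phi> k m)" for m using coding by (simp add: coding_def)
  note product_box = product_box[OF this]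
  have "\<forall>m. \<exists>A. countable A \<and> (\<forall>s t. \<phi> k m (g s \<otimes> g t) > 0 \<longrightarrow>
     (\<exists>F. finite F \<and> F \<subseteq> A \<and> (\<forall>x\<in>g ` cyl F s. \<forall>y\<in>g ` cyl F t. \<phi> k m (x \<otimes> y) > 0)))"
    by (rule allI, rule product_box)
  from choice[OF this] obtain A where A: "\<forall>m. countable (A m) \<and>
     (\<forall>s t. \<phi> k m (g s \<otimes> g t) > 0 \<longrightarrow>
     (\<exists>F. finite F \<and> F \<subseteq> A m \<and> (\<forall>x\<in>g ` cyl F s. \<forall>y\<in>g ` cyl F t. \<phi> k m (x \<otimes> y) > 0)))"
    by (elim exE)
  have "countable (\<Union>m. A m)" using A by simp
  from subset_range_from_nat_into[OF this]
  obtain e :: "nat \<Rightarrow> 'k" where e: "(\<Union>m. A m) \<subseteq> range e" by (rule that)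
  from cauchy_factors[OF assms, of e] obtain s t where st: "\<forall>n. \<forall>\<^sub>F q in \<F>.
     \<exists>u\<in>g ` cyl (e ` {..<n}) s. \<exists>v\<in>g ` cyl (e ` {..<n}) t. q = u \<otimes> v"
    by (elim exE)
  obtain m where m: "\<phi> k m (g s \<otimes> g t) > 0"
    using coding topspace_eq g_closed unfolding coding_def by (metis m_closed)
  from A[THEN spec, THEN conjunct2, THEN spec, THEN spec, THEN mp, OF this]
  obtain F where F: "finite F" "F \<subseteq> A m"
      "\<forall>x\<in>g ` cyl F s. \<forall>y\<in>g ` cyl F t. \<phi> k m (x \<otimes> y) > 0"
    by (elim exE conjE)
  have "F \<subseteq> e ` UNIV" using F(2) e by blast
  then obtain J where J: "finite J" "F = e ` J" using finite_subset_image[OF F(1)] by metis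
  obtain n where n: "J \<subseteq> {..<n}" using finite_nat_iff_bounded J(1) by blast
  have "F \<subseteq> e ` {..<n}" using J(2) n by blast
  then have sub: "g ` cyl (e ` {..<n}) s' \<subseteq> g ` cyl F s'" for s'
    by (intro image_mono) (auto simp: cyl_def)
  have "\<forall>\<^sub>F q in \<F>. \<phi> k m q > 0"
    using st[THEN spec, of n]
  proof eventually_elim
    case (elim q)
    then obtain u v where "u \<in> g ` cyl F s" "v \<in> g ` cyl F t" "q = u \<otimes> v"
      using sub by (metis subsetD)
    then show ?case using F(3) by blast
  qed
  then show ?thesis ..
qed

text \<open>By \<open>coding_box\<close>, the points of the filter are eventually in the image of any given box around \<open>w\<close>.\<close>

lemma cauchy_converges:
  assumes "cauchy \<F>"
  obtains z where "z \<in> carrier G" "\<And>U. openin T U \<Longrightarrow> z \<in> U \<Longrightarrow> \<forall>\<^sub>F q in \<F>. q \<in> U"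
proof -
  obtain w where w: "\<And>k. \<forall>\<^sub>F q in \<F>. \<phi> k (w k) q > 0"
    using cauchy_selects[OF assms] by metis
  have "\<forall>\<^sub>F q in \<F>. q \<in> U" if U: "openin T U" "g w \<in> U" for U
  proof -
    have "openin nat_power {v \<in> topspace nat_power. g v \<in> U}"
      using coding U(1) unfolding coding_def by (intro openin_continuous_map_preimage) auto
    then obtain C where C: "finite C" "cyl C w \<subseteq> {v \<in> topspace nat_power. g v \<in> U}"
      using open_cyl[of _ w] U(2) by auto
    have "\<forall>\<^sub>F q in \<F>. \<forall>k\<in>C. \<phi> k (w k) q > 0" using w C(1) by (simp add: eventually_ball_finite)
    moreover have "\<forall>\<^sub>F q in \<F>. q \<in> carrier G" using assms by (simp add: cauchy_def)
    ultimately show ?thesis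
    proof eventually_elim
      case (elim q)
      then have "q \<in> g ` cyl C w" by (intro coding_box[OF coding]) (auto simp: topspace_eq)
      then show ?case using C(2) by auto
    qed
  qed
  then show ?thesis using that g_closed by blast
qed

end

section \<open>Powers of the infinite symmetric group\<close>

lemma Bij_UNIV: "Bij UNIV = {f. bij f}"
  by (auto simp: Bij_def)

lemma topspace_S_inf_topology: "topspace S_inf_topology = Bij UNIV"
  by (simp add: S_inf_topology_def)

lemma topspace_S_inf_power: "topspace (S_inf_power_topology \<tau>) = (\<Pi>\<^sub>E i\<in>Field \<tau>. Bij UNIV)"
  by (simp add: S_inf_power_topology_def topspace_S_inf_topology)

lemma carrier_S_inf_power: "carrier (S_inf_power \<tau>) = (\<Pi>\<^sub>E i\<in>Field \<tau>. Bij UNIV)"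
  by (simp add: S_inf_power_def BijGroup_def)

lemma group_S_inf_power: "group (S_inf_power \<tau>)"
  unfolding S_inf_power_def by (rule product_group) (rule group_BijGroup)

lemma mult_S_inf_power:
  assumes "f \<in> carrier (S_inf_power \<tau>)" "f' \<in> carrier (S_inf_power \<tau>)"
  shows "f \<otimes>\<^bsub>S_inf_power \<tau>\<^esub> f' = (\<lambda>i\<in>Field \<tau>. f i \<circ> f' i)"
proof -
  have "f i \<in> Bij UNIV" "f' i \<in> Bij UNIV" if "i \<in> Field \<tau>" for i
    using assms that by (auto simp: carrier_S_inf_power)
  then show ?thesis
    by (auto simp: S_inf_power_def BijGroup_def compose_def o_def intro!: restrict_ext)
qed

lemma openin_S_inf_power_coord:
  assumes "i \<in> Field \<tau>"
  shows "openin (S_inf_power_topology \<tau>) {f \<in> topspace (S_inf_power_topology \<tau>). f i n = m}"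
proof -
  have "continuous_map (S_inf_power_topology \<tau>) S_inf_topology (\<lambda>f. f i)"
    unfolding S_inf_power_topology_def by (rule continuous_map_product_projection[OF assms])
  moreover have "openin S_inf_topology (Bij UNIV \<inter> {u. u n = m})"
    unfolding S_inf_topology_def by (rule openin_subtopology_Int2[OF openin_coord])
  ultimately have "openin (S_inf_power_topology \<tau>)
      {f \<in> topspace (S_inf_power_topology \<tau>). f i \<in> Bij UNIV \<inter> {u. u n = m}}"
    by (rule openin_continuous_map_preimage)
  moreover have "f i \<in> Bij UNIV" if "f \<in> topspace (S_inf_power_topology \<tau>)" for f
    using that assms by (auto simp: topspace_S_inf_power)
  ultimately show ?thesis by (auto elim!: back_subst[of "openin _"])
qed

lemma S_inf_power_box:
  assumes "openin (S_inf_power_topology \<tau>) U" "p \<in> U"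
  shows "\<exists>J. finite J \<and> J \<subseteq> Field \<tau> \<times> UNIV \<and>
     {f \<in> topspace (S_inf_power_topology \<tau>). \<forall>(i, n)\<in>J. f i n = p i n} \<subseteq> U"
proof -
  have "\<exists>W. finite {i \<in> Field \<tau>. W i \<noteq> topspace S_inf_topology} \<and>
      (\<forall>i\<in>Field \<tau>. openin S_inf_topology (W i)) \<and> p \<in> Pi\<^sub>E (Field \<tau>) W \<and> Pi\<^sub>E (Field \<tau>) W \<subseteq> U"
    using assms unfolding S_inf_power_topology_def openin_product_topology_alt by simp
  then obtain W where W: "finite {i \<in> Field \<tau>. W i \<noteq> topspace S_inf_topology}"
      "\<And>i. i \<in> Field \<tau> \<Longrightarrow> openin S_inf_topology (W i)" "p \<in> Pi\<^sub>E (Field \<tau>) W" "Pi\<^sub>E (Field \<tau>) W \<subseteq> U"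
    by (elim exE conjE) simp
  define I where "I = {i \<in> Field \<tau>. W i \<noteq> topspace S_inf_topology}"
  have "\<exists>C. finite C \<and> cyl C (p i) \<inter> Bij UNIV \<subseteq> W i" if i: "i \<in> Field \<tau>" for i
  proof -
    obtain V where V: "openin nat_power V" "W i = V \<inter> Bij UNIV"
      using W(2)[OF i] unfolding S_inf_topology_def openin_subtopology by blast
    have "p i \<in> V" using W(3) i V(2) by (auto simp: PiE_iff)
    then obtain C where "finite C" "cyl C (p i) \<subseteq> V" using open_cyl[OF V(1)] by blast
    then show ?thesis using V(2) by blast
  qed
  then obtain C where C: "\<And>i. i \<in> Field \<tau> \<Longrightarrow> finite (C i)"
      "\<And>i. i \<in> Field \<tau> \<Longrightarrow> cyl (C i) (p i) \<inter> Bij UNIV \<subseteq> W i"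
    by metis
  have box: "f \<in> Pi\<^sub>E (Field \<tau>) W"
    if f: "f \<in> topspace (S_inf_power_topology \<tau>)" "\<forall>(i, n)\<in>Sigma I C. f i n = p i n" for f
  proof (rule PiE_I)
    fix i assume i: "i \<in> Field \<tau>"
    have fi: "f i \<in> Bij UNIV" using f(1) i by (auto simp: topspace_S_inf_power)
    show "f i \<in> W i"
    proof (cases "i \<in> I")
      case True
      then have "f i \<in> cyl (C i) (p i)" using f(2) by (auto simp: cyl_def)
      then show ?thesis using C(2)[OF i] fi by blast
    next
      case False
      then show ?thesis using fi i by (simp add: I_def topspace_S_inf_topology)
    qed
  next
    fix i assume "i \<notin> Field \<tau>"
    then show "f i = undefined" using f(1) by (auto simp: topspace_S_inf_power PiE_iff extensional_def)
  qed
  show ?thesis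
  proof (intro exI[of _ "Sigma I C"] conjI subsetI)
    show "finite (Sigma I C)" using W(1) C(1) by (auto simp: I_def)
    show "f \<in> U" if "f \<in> {f \<in> topspace (S_inf_power_topology \<tau>). \<forall>(i, n)\<in>Sigma I C. f i n = p i n}" for f
      by (rule subsetD[OF W(4) box]) (use that in simp_all)
  qed (auto simp: I_def)
qed

text \<open>The basis consists of the stabilizers of the finite sets of points in the coordinates of the power.\<close>

lemma iso_closed_subgroup_imp_open_subgroup_basis:
  assumes G: "topological_group G T"
    and iso: "iso_closed_subgroup G T (S_inf_power \<tau>) (S_inf_power_topology \<tau>)"
  shows "open_subgroup_basis_at_one G T"
proof -
  interpret group G using G by (simp add: topological_group_def)
  let ?P = "S_inf_power \<tau>" and ?S = "S_inf_power_topology \<tau>"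
  have top: "topspace T = carrier G" using G by (simp add: topological_group_def)
  obtain H h where H: "subgroup H ?P" and h: "h \<in> iso G (?P\<lparr>carrier := H\<rparr>)"
    and homeo: "homeomorphic_map T (subtopology ?S H) h"
    using iso unfolding iso_closed_subgroup_def by blast
  have HP: "H \<subseteq> carrier ?P" using H by (rule subgroup.subset)
  have hH: "h x \<in> H" if "x \<in> carrier G" for x
    using h that by (auto simp: iso_def hom_def)
  then have hP: "h x \<in> carrier ?P" if "x \<in> carrier G" for x using HP that by blast
  have mult: "h (x \<otimes>\<^bsub>G\<^esub> y) i n = h x i (h y i n)"
    if "x \<in> carrier G" "y \<in> carrier G" "i \<in> Field \<tau>" for x y i n
  proof -
    have "h (x \<otimes>\<^bsub>G\<^esub> y) = h x \<otimes>\<^bsub>?P\<^esub> h y" using h that by (auto simp: iso_def hom_def)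
    then show ?thesis using that hP by (simp add: mult_S_inf_power)
  qed
  have one: "h \<one>\<^bsub>G\<^esub> i n = n" if i: "i \<in> Field \<tau>" for i n
  proof -
    have "h \<one>\<^bsub>G\<^esub> i \<in> Bij UNIV" using hP[OF one_closed] i by (auto simp: carrier_S_inf_power)
    then have "inj (h \<one>\<^bsub>G\<^esub> i)" by (simp add: Bij_UNIV bij_is_inj)
    moreover have "h \<one>\<^bsub>G\<^esub> i (h \<one>\<^bsub>G\<^esub> i n) = h \<one>\<^bsub>G\<^esub> i n" using mult[OF one_closed one_closed i, of n] by simp
    ultimately show ?thesis by (rule injD)
  qed
  have cont: "continuous_map T ?S h"
    using homeomorphic_imp_continuous_map[OF homeo] by (simp add: continuous_map_in_subtopology)
  define N where "N = (\<lambda>J. {x \<in> carrier G. \<forall>(i, n)\<in>J. h x i n = n})"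
  have subgroup: "subgroup (N J) G" if J: "J \<subseteq> Field \<tau> \<times> UNIV" for J
  proof (rule subgroupI)
    show "N J \<subseteq> carrier G" by (auto simp: N_def)
    have "\<one>\<^bsub>G\<^esub> \<in> N J" using J one by (auto simp: N_def)
    then show "N J \<noteq> {}" by blast
    fix a assume a: "a \<in> N J"
    have "h (inv\<^bsub>G\<^esub> a) i n = n" if "(i, n) \<in> J" for i n
    proof -
      have "a \<in> carrier G" "i \<in> Field \<tau>" "h a i n = n" using a that J by (auto simp: N_def)
      then show ?thesis using mult[of "inv\<^bsub>G\<^esub> a" a i n] one[of i n] by simp
    qed
    then show "inv\<^bsub>G\<^esub> a \<in> N J" using a by (auto simp: N_def)
    fix b assume "b \<in> N J"
    then show "a \<otimes>\<^bsub>G\<^esub> b \<in> N J" using a J mult by (fastforce simp: N_def)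
  qed
  have open_N: "openin T (N J)" if J: "finite J" "J \<subseteq> Field \<tau> \<times> UNIV" for J
    using J
  proof (induction J)
    case empty
    then show ?case using openin_topspace[of T] by (simp add: N_def top)
  next
    case (insert a J)
    obtain i n where a: "a = (i, n)" by (cases a)
    have "openin T {x \<in> topspace T. h x \<in> {f \<in> topspace ?S. f i n = n}}"
      using insert.prems a by (intro openin_continuous_map_preimage[OF cont] openin_S_inf_power_coord) auto
    moreover have "N (insert a J) = N J \<inter> {x \<in> topspace T. h x \<in> {f \<in> topspace ?S. f i n = n}}"
      using hP top by (auto simp: N_def a topspace_S_inf_power carrier_S_inf_power)
    ultimately show ?case using insert by (simp add: openin_Int)
  qed
  have "\<exists>J. finite J \<and> J \<subseteq> Field \<tau> \<times> UNIV \<and> N J \<subseteq> U" if U: "openin T U" "\<one>\<^bsub>G\<^esub> \<in> U" for U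
  proof -
    have "openin (subtopology ?S H) (h ` U)"
      using homeomorphic_imp_open_map[OF homeo] U(1) by (simp add: open_map_def)
    then obtain V where V: "openin ?S V" "h ` U = V \<inter> H" unfolding openin_subtopology by blast
    have "h \<one>\<^bsub>G\<^esub> \<in> V" using U(2) V(2) by blast
    from S_inf_power_box[OF V(1) this] obtain J where J: "finite J" "J \<subseteq> Field \<tau> \<times> UNIV"
        "{f \<in> topspace ?S. \<forall>(i, n)\<in>J. f i n = h \<one>\<^bsub>G\<^esub> i n} \<subseteq> V"
      by (elim exE conjE)
    have "x \<in> U" if x: "x \<in> N J" for x
    proof -
      have xG: "x \<in> carrier G" using x by (simp add: N_def)
      have "h x \<in> topspace ?S" using hP[OF xG] by (simp add: topspace_S_inf_power carrier_S_inf_power)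
      moreover have "\<forall>(i, n)\<in>J. h x i n = h \<one>\<^bsub>G\<^esub> i n"
      proof clarify
        fix i n assume "(i, n) \<in> J"
        then have "i \<in> Field \<tau>" "h x i n = n" using x J(2) by (auto simp: N_def)
        then show "h x i n = h \<one>\<^bsub>G\<^esub> i n" using one by simp
      qed
      ultimately have "h x \<in> h ` U" using J(3) V(2) hH[OF xG] by blast
      then obtain u where u: "u \<in> U" "h x = h u" by blast
      moreover have "u \<in> carrier G" using u(1) openin_subset[OF U(1)] top by blast
      moreover have "inj_on h (carrier G)" using h by (simp add: iso_def bij_betw_def)
      ultimately show ?thesis using xG by (metis inj_onD)
    qed
    then show ?thesis using J by blast
  qed
  then show ?thesis unfolding open_subgroup_basis_at_one_def
    using subgroup open_N by (intro exI[of _ "N ` {J. finite J \<and> J \<subseteq> Field \<tau> \<times> UNIV}"]) auto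
qed

section \<open>The embedding given by the actions on cosets\<close>

context group
begin

text \<open>Left translation, carried over to the labels of left cosets. Numbers that are not labels are fixed, so that
  the action is by permutations of all natural numbers also if the index is finite.\<close>

definition coset_action :: "('a \<Rightarrow> nat) \<Rightarrow> 'a \<Rightarrow> nat \<Rightarrow> nat" where
  "coset_action c x n =
     (if \<exists>a\<in>carrier G. c a = n then c (x \<otimes> (SOME a. a \<in> carrier G \<and> c a = n)) else n)"

definition coset_label :: "'a set \<Rightarrow> ('a \<Rightarrow> nat) \<Rightarrow> bool" where
  "coset_label H c \<longleftrightarrow> subgroup H G \<and>
     (\<forall>x\<in>carrier G. \<forall>y\<in>carrier G. c x = c y \<longleftrightarrow> inv x \<otimes> y \<in> H)"

lemma coset_action_label:
  assumes "coset_label H c" "x \<in> carrier G" "a \<in> carrier G"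
  shows "coset_action c x (c a) = c (x \<otimes> a)"
proof -
  define b where "b = (SOME b. b \<in> carrier G \<and> c b = c a)"
  have b: "b \<in> carrier G" "c b = c a"
    using someI[of "\<lambda>b. b \<in> carrier G \<and> c b = c a" a] assms(3) unfolding b_def by auto
  have "inv (x \<otimes> b) \<otimes> (x \<otimes> a) = inv b \<otimes> (inv x \<otimes> (x \<otimes> a))"
    using b(1) assms(2,3) by (simp add: inv_mult_group m_assoc)
  also have "\<dots> = inv b \<otimes> a" using assms(2,3) by (simp add: m_assoc[symmetric])
  finally have "c (x \<otimes> b) = c (x \<otimes> a)"
    using assms b unfolding coset_label_def by (metis m_closed)
  then show ?thesis using assms(3) by (auto simp: coset_action_def b_def)
qed

lemma coset_action_one:
  assumes "coset_label H c"
  shows "coset_action c \<one> n = n"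
proof (cases "\<exists>a\<in>carrier G. c a = n")
  case True
  then show ?thesis using coset_action_label[OF assms one_closed] by auto
qed (simp add: coset_action_def)

lemma coset_action_mult:
  assumes "coset_label H c" "x \<in> carrier G" "y \<in> carrier G"
  shows "coset_action c (x \<otimes> y) n = coset_action c x (coset_action c y n)"
proof (cases "\<exists>a\<in>carrier G. c a = n")
  case True
  then obtain a where a: "a \<in> carrier G" "n = c a" by blast
  then show ?thesis using assms by (simp add: coset_action_label[OF assms(1)] m_assoc)
qed (simp add: coset_action_def)

lemma bij_coset_action:
  assumes "coset_label H c" "x \<in> carrier G"
  shows "bij (coset_action c x)"
proof (rule o_bij)
  show "coset_action c (inv x) \<circ> coset_action c x = id"
    using coset_action_mult[OF assms(1), of "inv x" x] coset_action_one[OF assms(1)] assms(2)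
    by (auto simp: fun_eq_iff)
  show "coset_action c x \<circ> coset_action c (inv x) = id"
    using coset_action_mult[OF assms(1), of x "inv x"] coset_action_one[OF assms(1)] assms(2)
    by (auto simp: fun_eq_iff)
qed

end

context coded_nonarchimedean_group
begin

text \<open>The factor with index \<open>i\<close> is the action on the cosets of an open subgroup \<open>K i\<close> contained in the \<open>i\<close>-th
  set of the base, if that set contains the identity. The permutation given by \<open>x\<close> sends the label of
  \<open>K i\<close> to that of the coset of \<open>x\<close>; hence finitely many coordinates of the image determine
  \<open>x\<close> up to any prescribed neighborhood, and the embedding is open onto its image.

  For closedness, pull back the neighborhoods of a point \<open>p\<close> of the closure. The coset of \<open>x\<close> is the image
  of the label of \<open>K i\<close>, and the coset of \<open>inv x\<close> is its preimage. Since \<open>p i\<close> is a bijection, both are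
  eventually constant, so that the filter is Cauchy, and by continuity \<open>p\<close> is the image of its
  limit.\<close>

lemma iso_closed_subgroup_S_inf_power:
  fixes \<tau> :: "'i rel"
  assumes haus: "Hausdorff_space T" and base: "base_of T \<B>" "|\<B>| =o \<tau>" and card: "Card_order \<tau>"
  shows "iso_closed_subgroup G T (S_inf_power \<tau>) (S_inf_power_topology \<tau>)"
proof -
  let ?P = "S_inf_power \<tau>" and ?S = "S_inf_power_topology \<tau>" and ?I = "Field \<tau>"
  have "|?I| =o |\<B>|"
    using card_of_Field_ordIso[OF card] ordIso_symmetric[OF base(2)] by (rule ordIso_transitive)
  from card_of_ordIso[THEN iffD2, OF this] obtain \<beta> where \<beta>: "bij_betw \<beta> ?I \<B>" by (elim exE)
  have "\<exists>K. open_subgroup K \<and> (\<one> \<in> \<beta> i \<longrightarrow> K \<subseteq> \<beta> i)" if i: "i \<in> ?I" for i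
  proof (cases "\<one> \<in> \<beta> i")
    case True
    have "openin T (\<beta> i)" using \<beta> i base(1) by (auto simp: base_of_def bij_betw_def)
    then show ?thesis using basis True unfolding open_subgroup_basis_at_one_def open_subgroup_def by blast
  next
    case False
    then show ?thesis using open_subgroup_carrier by blast
  qed
  then obtain K where K: "\<And>i. i \<in> ?I \<Longrightarrow> open_subgroup (K i)"
      "\<And>i. i \<in> ?I \<Longrightarrow> \<one> \<in> \<beta> i \<Longrightarrow> K i \<subseteq> \<beta> i" by metis
  have small: "\<exists>i\<in>?I. K i \<subseteq> U" if U: "openin T U" "\<one> \<in> U" for U
  proof -
    obtain V where V: "V \<in> \<B>" "\<one> \<in> V" "V \<subseteq> U" using base(1) U unfolding base_of_def by blast
    then obtain i where "i \<in> ?I" "\<beta> i = V" using \<beta> by (auto simp: bij_betw_def)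
    then show ?thesis using K(2) V by blast
  qed
  have "\<exists>c. coset_label (K i) c" if "i \<in> ?I" for i
    using countable_cosets[OF K(1)[OF that]] K(1)[OF that] unfolding coset_label_def open_subgroup_def by metis
  then obtain c where c: "\<And>i. i \<in> ?I \<Longrightarrow> coset_label (K i) (c i)" by metis
  have label: "c i x = c i y \<longleftrightarrow> inv x \<otimes> y \<in> K i"
    if "i \<in> ?I" "x \<in> carrier G" "y \<in> carrier G" for i x y
    using c[OF that(1)] that unfolding coset_label_def by blast
  have separate: "\<exists>i\<in>?I. \<forall>y\<in>carrier G. c i x = c i y \<longrightarrow> y \<in> U" if U: "openin T U" "x \<in> U" for U x
  proof -
    have xG: "x \<in> carrier G" using U openin_subset topspace_eq by blast
    obtain L where L: "open_subgroup L" "\<And>k. k \<in> L \<Longrightarrow> x \<otimes> k \<in> U"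
      by (rule ex_open_subgroup_translate[OF U], rule that)
    have "openin T L" "\<one> \<in> L" using L(1) subgroup.one_closed unfolding open_subgroup_def by blast+
    then obtain i where i: "i \<in> ?I" "K i \<subseteq> L" using small by blast
    have "y \<in> U" if "y \<in> carrier G" "c i x = c i y" for y
    proof -
      have "x \<otimes> (inv x \<otimes> y) \<in> U" using L(2) i(2) label[OF i(1) xG that(1)] that(2) by blast
      then show ?thesis using xG that(1) by (simp add: cancel_left)
    qed
    then show ?thesis using i(1) by blast
  qed
  define h where "h = (\<lambda>x. \<lambda>i\<in>?I. coset_action (c i) x)"
  have h_one: "h x i (c i \<one>) = c i x" if "i \<in> ?I" "x \<in> carrier G" for i x
    using coset_action_label[OF c[OF that(1)] that(2) one_closed] that by (simp add: h_def)
  have hP: "h x \<in> carrier ?P" if "x \<in> carrier G" for x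
    using bij_coset_action[OF c that] by (auto simp: h_def carrier_S_inf_power Bij_UNIV)
  have hS: "h x \<in> topspace ?S" if "x \<in> carrier G" for x
    using hP[OF that] by (simp add: carrier_S_inf_power topspace_S_inf_power)
  have hom: "h \<in> hom G ?P"
  proof (rule homI)
    fix x y assume xy: "x \<in> carrier G" "y \<in> carrier G"
    have "coset_action (c i) (x \<otimes> y) = coset_action (c i) x \<circ> coset_action (c i) y" if "i \<in> ?I" for i
      using coset_action_mult[OF c[OF that] xy] by (auto simp: fun_eq_iff)
    then show "h (x \<otimes> y) = h x \<otimes>\<^bsub>?P\<^esub> h y"
      unfolding mult_S_inf_power[OF hP[OF xy(1)] hP[OF xy(2)]] by (auto simp: h_def intro!: restrict_ext)
  qed (rule hP)
  have inj: "inj_on h (carrier G)"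
  proof (rule inj_onI, rule ccontr)
    fix x y assume xy: "x \<in> carrier G" "y \<in> carrier G" "h x = h y" "x \<noteq> y"
    then obtain U where U: "openin T U" "x \<in> U" "y \<notin> U"
      using haus topspace_eq unfolding Hausdorff_space_def disjnt_iff by metis
    obtain i where "i \<in> ?I" "\<forall>y\<in>carrier G. c i x = c i y \<longrightarrow> y \<in> U" using separate[OF U(1,2)] by blast
    then show False using xy U(3) h_one by metis
  qed
  have cont: "continuous_map T ?S h"
    unfolding S_inf_power_topology_def continuous_map_componentwise
  proof (intro conjI ballI)
    show "h ` topspace T \<subseteq> extensional ?I" by (auto simp: h_def)
    fix i assume i: "i \<in> ?I"
    have "continuous_map T (discrete_topology UNIV) (\<lambda>x. h x i n)" for n
    proof (cases "\<exists>a\<in>carrier G. c i a = n")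
      case True
      then obtain a where a: "a \<in> carrier G" "n = c i a" by blast
      have eq: "h x i n = c i (x \<otimes> a)" if "x \<in> carrier G" for x
        using coset_action_label[OF c[OF i] that a(1)] i by (simp add: h_def a(2))
      have "openin T {x \<in> topspace T. h x i n \<in> A}" for A
      proof (subst openin_subopen, intro ballI)
        fix x assume "x \<in> {x \<in> topspace T. h x i n \<in> A}"
        then have x: "x \<in> carrier G" "h x i n \<in> A" using topspace_eq by auto
        define W where "W = {y \<in> topspace T. inv (x \<otimes> a) \<otimes> (y \<otimes> a) \<in> K i}"
        have "continuous_map T T (\<lambda>y. inv (x \<otimes> a) \<otimes> (y \<otimes> a))"
          using x(1) a(1) topspace_eq by (intro continuous_map_mult) auto
        then have "openin T W" unfolding W_def using K(1)[OF i]
          by (intro openin_continuous_map_preimage) (auto simp: open_subgroup_def)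
        moreover have "x \<in> W"
          using x(1) a(1) K(1)[OF i] by (auto simp: W_def topspace_eq open_subgroup_def subgroup.one_closed)
        moreover have "h y i n = h x i n" if "y \<in> W" for y
          using that x(1) a(1) label[OF i, of "x \<otimes> a" "y \<otimes> a"] by (simp add: W_def topspace_eq eq)
        then have "W \<subseteq> {x \<in> topspace T. h x i n \<in> A}" using x(2) by (auto simp: W_def)
        ultimately show "\<exists>W. openin T W \<and> x \<in> W \<and> W \<subseteq> {x \<in> topspace T. h x i n \<in> A}" by blast
      qed
      then show ?thesis by (simp add: continuous_map_def)
    next
      case False
      then have "(\<lambda>x. h x i n) = (\<lambda>x. n)" using i by (simp add: h_def coset_action_def)
      then show ?thesis by simp
    qed
    then show "continuous_map T S_inf_topology (\<lambda>x. h x i)"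
      unfolding S_inf_topology_def continuous_map_in_subtopology continuous_map_componentwise_UNIV
      using hS i topspace_eq by (auto simp: topspace_S_inf_power)
  qed
  define H where "H = h ` carrier G"
  have "open_map T (subtopology ?S H) h"
    unfolding open_map_def
  proof (intro allI impI)
    fix U assume U: "openin T U"
    show "openin (subtopology ?S H) (h ` U)"
    proof (subst openin_subopen, intro ballI)
      fix f assume "f \<in> h ` U"
      then obtain x where x: "x \<in> U" "f = h x" by blast
      have xG: "x \<in> carrier G" using x U openin_subset topspace_eq by blast
      obtain i where i: "i \<in> ?I" "\<forall>y\<in>carrier G. c i x = c i y \<longrightarrow> y \<in> U" using separate[OF U x(1)] by blast
      define W where "W = H \<inter> {f \<in> topspace ?S. f i (c i \<one>) = c i x}"
      have "openin (subtopology ?S H) W" unfolding W_def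
        by (rule openin_subtopology_Int2[OF openin_S_inf_power_coord[OF i(1)]])
      moreover have "f \<in> W" using x(2) xG hS h_one[OF i(1)] by (auto simp: W_def H_def)
      moreover have "W \<subseteq> h ` U" using i(2) h_one[OF i(1)] by (force simp: W_def H_def)
      ultimately show "\<exists>W. openin (subtopology ?S H) W \<and> f \<in> W \<and> W \<subseteq> h ` U" by blast
    qed
  qed
  moreover have "continuous_map T (subtopology ?S H) h"
    using cont by (auto simp: continuous_map_in_subtopology H_def topspace_eq)
  moreover have "h ` topspace T = topspace (subtopology ?S H)"
    using hS by (auto simp: H_def topspace_eq)
  ultimately have homeo: "homeomorphic_map T (subtopology ?S H) h"
    using inj by (intro bijective_open_imp_homeomorphic_map) (auto simp: topspace_eq)
  have "?S closure_of H \<subseteq> H"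
  proof
    fix p assume p: "p \<in> ?S closure_of H"
    have pS: "p \<in> topspace ?S" using p by (simp add: in_closure_of)
    define \<F> where "\<F> = inf (filtercomap h (nhdsin ?S p)) (principal (carrier G))"
    have evV: "\<forall>\<^sub>F x in \<F>. x \<in> carrier G \<and> h x \<in> V" if "openin ?S V" "p \<in> V" for V
      unfolding \<F>_def eventually_inf_principal eventually_filtercomap eventually_nhdsin using that
      by (intro exI[of _ "\<lambda>f. f \<in> V"]) auto
    have ev: "\<forall>\<^sub>F x in \<F>. x \<in> carrier G \<and> h x i n = p i n" if "i \<in> ?I" for i n
      using evV[OF openin_S_inf_power_coord[OF that, of n "p i n"]] pS
      by (auto elim!: eventually_mono)
    have ne: "\<F> \<noteq> bot"
    proof
      assume "\<F> = bot"
      then have "eventually (\<lambda>_. False) \<F>" by simp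
      then obtain V where "openin ?S V" "p \<in> V" "\<forall>x\<in>carrier G. h x \<notin> V"
        using pS unfolding \<F>_def eventually_inf_principal eventually_filtercomap eventually_nhdsin
        by blast
      then show False using p unfolding in_closure_of H_def by blast
    qed
    have "cauchy \<F>"
      unfolding cauchy_def
    proof (intro conjI allI impI)
      show "\<forall>\<^sub>F q in \<F>. q \<in> carrier G" using evV[OF openin_topspace pS] by (rule eventually_mono) blast
      fix L assume "open_subgroup L"
      then have "openin T L" "\<one> \<in> L" using subgroup.one_closed unfolding open_subgroup_def by blast+
      then obtain i where i: "i \<in> ?I" "K i \<subseteq> L" using small by blast
      show "\<exists>a\<in>carrier G. \<forall>\<^sub>F q in \<F>. inv a \<otimes> q \<in> L"
      proof -
        have *: "\<forall>\<^sub>F q in \<F>. q \<in> carrier G \<and> c i q = p i (c i \<one>)"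
          using ev[OF i(1), of "c i \<one>"] by (rule eventually_mono) (use h_one[OF i(1)] in auto)
        then obtain a where a: "a \<in> carrier G" "c i a = p i (c i \<one>)"
          using eventually_happens'[OF ne] by blast
        have "\<forall>\<^sub>F q in \<F>. inv a \<otimes> q \<in> L"
          using *
        proof eventually_elim
          case (elim q)
          then have "inv a \<otimes> q \<in> K i" using label[OF i(1) a(1), of q] a(2) by simp
          then show ?case using i(2) by blast
        qed
        then show ?thesis using a(1) by blast
      qed
      show "\<exists>b\<in>carrier G. \<forall>\<^sub>F q in \<F>. q \<otimes> inv b \<in> L"
      proof -
        have "bij (p i)" using pS i(1) by (auto simp: topspace_S_inf_power Bij_UNIV)
        then obtain j where j: "p i j = c i \<one>" by (metis bij_is_surj surjD)
        have *: "\<forall>\<^sub>F q in \<F>. q \<in> carrier G \<and> c i (inv q) = j"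
          using ev[OF i(1), of j]
        proof eventually_elim
          case (elim q)
          then have q: "q \<in> carrier G" "h q i j = c i \<one>" using j by auto
          have "h q i (c i (inv q)) = c i \<one>"
            using coset_action_label[OF c[OF i(1)] q(1), of "inv q"] q(1) i(1) by (simp add: h_def)
          moreover have "inj (h q i)"
            using bij_coset_action[OF c[OF i(1)] q(1)] i(1) by (simp add: h_def bij_is_inj)
          ultimately show ?case using q injD[of "h q i" "c i (inv q)" j] by simp
        qed
        then obtain b where b: "b \<in> carrier G" "c i (inv b) = j"
          using eventually_happens'[OF ne] by blast
        have "\<forall>\<^sub>F q in \<F>. q \<otimes> inv b \<in> L"
          using *
        proof eventually_elim
          case (elim q)
          then have "inv (inv q) \<otimes> inv b \<in> K i"
            using label[OF i(1), of "inv q" "inv b"] b by simp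
          then show ?case using i(2) elim by auto
        qed
        then show ?thesis using b(1) by blast
      qed
    qed (rule ne)
    then obtain z where z: "z \<in> carrier G" "\<And>U. openin T U \<Longrightarrow> z \<in> U \<Longrightarrow> \<forall>\<^sub>F q in \<F>. q \<in> U"
      using cauchy_converges by blast
    have "p i n = h z i n" if i: "i \<in> ?I" for i n
    proof -
      have "openin T {x \<in> topspace T. h x \<in> {f \<in> topspace ?S. f i n = h z i n}}"
        by (intro openin_continuous_map_preimage[OF cont] openin_S_inf_power_coord i)
      then have "\<forall>\<^sub>F x in \<F>. x \<in> {x \<in> topspace T. h x \<in> {f \<in> topspace ?S. f i n = h z i n}}"
        by (rule z(2)) (use z(1) hS topspace_eq in auto)
      then have "\<exists>x. h x i n = h z i n \<and> h x i n = p i n"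
        using eventually_happens'[OF ne eventually_conj[OF _ ev[OF i, of n]]] by blast
      then show ?thesis by auto
    qed
    then have "p = h z"
      using pS hS[OF z(1)] unfolding topspace_S_inf_power
      by (intro PiE_ext[of _ ?I "\<lambda>_. Bij UNIV"]) auto
    then show "p \<in> H" using z(1) by (simp add: H_def)
  qed
  moreover have "H \<subseteq> topspace ?S" using hS by (auto simp: H_def)
  ultimately have closed: "closedin ?S H"
    using closure_of_subset[of H ?S] closure_of_eq by blast
  have "group_hom G ?P h"
    using hom group_S_inf_power by (simp add: group_hom_def group_hom_axioms_def is_group)
  then have subgroup: "subgroup H ?P" unfolding H_def by (rule group_hom.img_is_subgroup)
  have "h \<in> iso G (?P\<lparr>carrier := H\<rparr>)"
    using hom inj by (auto simp: iso_def hom_def bij_betw_def H_def)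
  then show ?thesis unfolding iso_closed_subgroup_def using subgroup closed homeo by blast
qed

end

theorem theorem4p4:
  fixes G :: "('a, 'b) monoid_scheme" and T :: "'a topology" and \<tau> :: "'i rel"
  assumes "Card_order \<tau>" and "natLeq \<le>o \<tau>"
    and "AE0_group G T" and "has_weight T \<tau>"
  shows "iso_closed_subgroup G T (S_inf_power \<tau>) (S_inf_power_topology \<tau>)
     \<longleftrightarrow> open_subgroup_basis_at_one G T"
proof
  have G: "topological_group G T" and AE0: "AE0_space T"
    using assms(3) by (auto simp: AE0_group_def)
  show "open_subgroup_basis_at_one G T"
    if "iso_closed_subgroup G T (S_inf_power \<tau>) (S_inf_power_topology \<tau>)"
    using G that by (rule iso_closed_subgroup_imp_open_subgroup_basis)
  assume basis: "open_subgroup_basis_at_one G T"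
  from AE0_space_coding[OF AE0]
  obtain \<phi> :: "('a \<Rightarrow> real) \<times> nat \<Rightarrow> nat \<Rightarrow> 'a \<Rightarrow> real" and g where coding: "coding T \<phi> g"
    by (elim exE)
  have "group G" using G by (simp add: topological_group_def)
  then interpret coded_nonarchimedean_group G T \<phi> g
    using G basis coding
    by (intro coded_nonarchimedean_group.intro nonarchimedean_group.intro
        coded_nonarchimedean_group_axioms.intro nonarchimedean_group_axioms.intro)
  obtain \<B> where "base_of T \<B>" "|\<B>| =o \<tau>" using assms(4) by (auto simp: has_weight_def)
  moreover have "Hausdorff_space T" using AE0 by (auto simp: AE0_space_def Tychonoff_space_def)
  ultimately show "iso_closed_subgroup G T (S_inf_power \<tau>) (S_inf_power_topology \<tau>)"
    using assms(1) by (intro iso_closed_subgroup_S_inf_power)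
qed

end
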